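(* Let $d$ be a non-negative integer. Then there are infinitely many primes $p$ with $p\equiv 1\pmod 4$ such that $\mathrm{Rab}_{\geq}(P_p,d)<\lfloor \mathrm{Haem}_{\geq}(P_p,d)\rfloor$.
   Context: For a prime $p\equiv1\pmod4$, the Paley graph $P_p$ has vertex set $\mathbb F_p$, two vertices being adjacent iff their difference is a nonzero square in $\mathbb F_p$; it is strongly regular with parameters $(v,k,\lambda,\mu)=(p,(p-1)/2,(p-5)/4,(p-1)/4)$ (i.e. $v$ vertices, $k$-regular, adjacent vertices have $\lambda$ common neighbours, distinct non-adjacent vertices have $\mu$ common neighbours), with restricted eigenvalues $\rho>\sigma$ the roots of $t^2-(\lambda-\mu)t-(k-\mu)=0$, namely $\sigma=(-\sqrt p-1)/2$. For such a graph $\Gamma$ and non-negative integer $d$: $\mathrm{Haem}_{\geq}(\Gamma,d)=v\frac{d-\sigma}{k-\sigma}$; $R_\Gamma(x,y,d)=x(x+1)(v-y)-2xyk+(2x+\lambda-\mu+1)yd+y(y-1)\mu-yd^2$; $S_d=\{y\in\{d+1,\dots,v\}: R_\Gamma(x,y,d)\ge0\text{ for all integers }x\}$; $\mathrm{Rab}_{\geq}(\Gamma,d)=\max S_d$ if $S_d\ne\emptyset$, else $0$. *)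

theory Defs
  imports Complex_Main "HOL-Number_Theory.Number_Theory" "Graph_Theory.Pair_Digraph"
begin

text \<open>
  A finite simple graph is a \<^locale>\<open>pair_graph\<close>: a finite, loop-free digraph without parallel
  arcs whose arc set is symmetric, so that each edge is represented by its two orientations.
\<close>

text \<open>
  The vertices are the residues \<open>0, \<dots>, p - 1\<close>, representing the field of order \<open>p\<close>. The arc
  relation is symmetric only if \<open>-1\<close> is a square, e.g. for primes \<open>p\<close> with \<open>[p = 1] (mod 4)\<close>.
\<close>

definition paley_graph :: "nat \<Rightarrow> int pair_pre_digraph" where
  "paley_graph p =
     \<lparr>pverts = {0..<int p},
      parcs = {(x, y). x \<in> {0..<int p} \<and> y \<in> {0..<int p} \<and>
                       [x - y \<noteq> 0] (mod int p) \<and> QuadRes (int p) (x - y)}\<rparr>"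

definition neighbours :: "'a pair_pre_digraph \<Rightarrow> 'a \<Rightarrow> 'a set" where
  "neighbours G x = {y. (x, y) \<in> parcs G}"

definition strongly_regular ::
  "'a pair_pre_digraph \<Rightarrow> nat \<Rightarrow> nat \<Rightarrow> nat \<Rightarrow> nat \<Rightarrow> bool" where
  "strongly_regular G v k lam mu \<longleftrightarrow>
     pair_graph G \<and> card (pverts G) = v \<and>
     (\<forall>x\<in>pverts G. card (neighbours G x) = k) \<and>
     (\<forall>x\<in>pverts G. \<forall>y\<in>pverts G. (x, y) \<in> parcs G \<longrightarrow>
        card (neighbours G x \<inter> neighbours G y) = lam) \<and>
     (\<forall>x\<in>pverts G. \<forall>y\<in>pverts G. x \<noteq> y \<and> (x, y) \<notin> parcs G \<longrightarrow>
        card (neighbours G x \<inter> neighbours G y) = mu)"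

text \<open>
  The parameters \<open>(v, k, \<lambda>, \<mu>)\<close> are determined by the graph as soon as it is neither complete nor
  edgeless, which is shown below; \<open>srg_params\<close> is meaningful for these graphs only.
\<close>

definition srg_params :: "'a pair_pre_digraph \<Rightarrow> nat \<times> nat \<times> nat \<times> nat" where
  "srg_params G = (THE (v, k, lam, mu). strongly_regular G v k lam mu)"

lemma srg_params_eq:
  assumes srg: "strongly_regular G v k lam mu"
    and adj: "a \<in> pverts G" "b \<in> pverts G" "(a, b) \<in> parcs G"
    and nonadj: "c \<in> pverts G" "e \<in> pverts G" "c \<noteq> e" "(c, e) \<notin> parcs G"
  shows "srg_params G = (v, k, lam, mu)"
  unfolding srg_params_def
proof (rule the_equality)
  show "case (v, k, lam, mu) of (v, k, lam, mu) \<Rightarrow> strongly_regular G v k lam mu"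
    using srg by simp
next
  fix q :: "nat \<times> nat \<times> nat \<times> nat"
  assume q: "case q of (v, k, lam, mu) \<Rightarrow> strongly_regular G v k lam mu"
  obtain v' k' lam' mu' where q_eq: "q = (v', k', lam', mu')"
    by (cases q)
  then have srg': "strongly_regular G v' k' lam' mu'"
    using q by simp
  have "v' = v"
    using srg srg' unfolding strongly_regular_def by blast
  moreover have "k' = k"
    using srg srg' adj(1) unfolding strongly_regular_def by metis
  moreover have "lam' = lam"
    using srg srg' adj unfolding strongly_regular_def by metis
  moreover have "mu' = mu"
    using srg srg' nonadj unfolding strongly_regular_def by metis
  ultimately show "q = (v, k, lam, mu)"
    using q_eq by simp
qed

definition restricted_eigenvalues :: "'a pair_pre_digraph \<Rightarrow> real set" where
  "restricted_eigenvalues G = (case srg_params G of (v, k, lam, mu) \<Rightarrow>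
     {t. t\<^sup>2 - (real lam - real mu) * t - (real k - real mu) = 0})"

text \<open>The smaller of the two restricted eigenvalues, written \<open>\<sigma>\<close> in the literature.\<close>

definition srg_sigma :: "'a pair_pre_digraph \<Rightarrow> real" where
  "srg_sigma G = Min (restricted_eigenvalues G)"

definition haem_ge :: "'a pair_pre_digraph \<Rightarrow> nat \<Rightarrow> real" where
  "haem_ge G d = (case srg_params G of (v, k, lam, mu) \<Rightarrow>
     real v * ((real d - srg_sigma G) / (real k - srg_sigma G)))"

definition srg_R :: "'a pair_pre_digraph \<Rightarrow> int \<Rightarrow> int \<Rightarrow> int \<Rightarrow> int" where
  "srg_R G x y d = (case srg_params G of (v, k, lam, mu) \<Rightarrow>
     x * (x + 1) * (int v - y) - 2 * x * y * int k
       + (2 * x + int lam - int mu + 1) * y * d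
       + y * (y - 1) * int mu - y * d\<^sup>2)"

definition rab_set :: "'a pair_pre_digraph \<Rightarrow> nat \<Rightarrow> nat set" where
  "rab_set G d = (case srg_params G of (v, k, lam, mu) \<Rightarrow>
     {y \<in> {d + 1..v}. \<forall>x. srg_R G x (int y) (int d) \<ge> 0})"

definition rab_ge :: "'a pair_pre_digraph \<Rightarrow> nat \<Rightarrow> nat" where
  "rab_ge G d = (if rab_set G d \<noteq> {} then Max (rab_set G d) else 0)"

end

theory Submission
  imports
    Defs
    "HOL-Analysis.Analysis"
    "HOL-Computational_Algebra.Squarefree"
    "HOL-Real_Asymp.Real_Asymp"
begin

text \<open>
  For \<open>y = 2 n + 2 d\<close> the form \<open>R\<close> at \<open>x = n + d\<close> equals \<open>(n + d) ((p + 1) / 2 - 2 n\<^sup>2 - n - d)\<close>, while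
  for larger \<open>y\<close> already the real discriminant of \<open>R\<close> in \<open>x\<close> forces a negative value at an integer.
  As the eigenvalue bound is \<open>\<surd>p + 2 d - 2 d / (\<surd>p + 1)\<close>, it suffices to find infinitely many primes
  \<open>p\<close> congruent to \<open>1\<close> modulo \<open>4\<close> such that \<open>\<surd>p\<close> exceeds an even integer by an amount
  between \<open>\<eta>\<close> and \<open>1 / 2 - \<eta>\<close> for some fixed \<open>\<eta> > 0\<close>.

  These come from Vinogradov's method: sums of \<open>\<Lambda>(n) \<chi>(n) e(h \<surd>n / 2)\<close> with \<open>h \<le> 4\<close> and \<open>\<chi>\<close> modulo
  \<open>4\<close> have a power saving by Vaughan's identity, where all inner sums have slowly varying phases, so
  that the Kusmin-Landau inequality is enough. On the other hand the sum of \<open>\<Lambda>(n)\<close> over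
  \<open>n \<equiv> 1 (mod 4)\<close> has no power saving, since otherwise \<open>\<Sum> \<chi>\<^sub>4(n) ln n / n\<close> would tend to \<open>-\<infinity>\<close>. A
  trigonometric polynomial of degree \<open>4\<close> with positive mean that is positive only in the wanted window
  joins the two facts.
\<close>

section \<open>Exponential sums over square roots\<close>

text \<open>The length 1/2 of the window comes from parity. For fixed d and large n with p about 4
  n^2, the real minimum of \<open>R\<close> in x at y = 2 n + 2 d lies close to the integer n + d.
  So \<open>R\<close> is already negative there when p is below roughly (2 n + 1/2)^2, although p
  exceeds (2 n)^2; and every larger y < p has (y - 2 d)^2 > p, which is what the discriminant asks
  for. The margin \<open>eta\<close> absorbs 2 d / (sqrt p + 1) on one side and the bounded terms on
  the other.

  The degree 4 is forced by the shape of the cut-off: under the weight (1 + cos u)^k the mean of cos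
  u is k / (k + 1). A window of half-width pi / 4 in u needs a cut-off above cos (pi / 4) =
  0.707..., which k = 2 does not reach and k = 3 does. Hence frequencies h / 2 between 1/2 and 2.

  The phases are slow because the square root is: after Cauchy-Schwarz, the phase is theta (sqrt a -
  sqrt a') sqrt b with a, a' in one dyadic block, and its increments are at most 1/2 once b is at
  least as large as the block. This is why the larger variable is always the inner one.\<close>

lemma cot_antimono:
  fixes x y :: real
  assumes "0 < x" "x \<le> y" "y < pi"
  shows "cot y \<le> cot x"
proof -
  have "sin x > 0" "sin y > 0" "sin (y - x) \<ge> 0"
    using assms by (auto intro!: sin_gt_zero sin_ge_zero)
  moreover from this have "cot x - cot y = sin (y - x) / (sin x * sin y)"
    by (simp add: cot_def sin_diff field_simps)
  ultimately have "cot x - cot y \<ge> 0" by simp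
  thus ?thesis by simp
qed

lemma cot_le_inverse:
  fixes t :: real
  assumes "0 < t" "t \<le> pi / 2"
  shows "cot t \<le> 1 / t"
proof -
  have "(\<lambda>x. sin x - x * cos x) 0 \<le> (\<lambda>x. sin x - x * cos x) t"
  proof (rule DERIV_nonneg_imp_nondecreasing[where f = "\<lambda>x. sin x - x * cos x" and a = 0 and b = t])
    fix x :: real assume x: "0 \<le> x" "x \<le> t"
    have "((\<lambda>x. sin x - x * cos x) has_real_derivative x * sin x) (at x)"
      by (auto intro!: derivative_eq_intros)
    moreover have "x * sin x \<ge> 0"
      using x assms by (intro mult_nonneg_nonneg sin_ge_zero) auto
    ultimately show "\<exists>y. ((\<lambda>x. sin x - x * cos x) has_real_derivative y) (at x) \<and> 0 \<le> y"
      by blast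
  qed (use assms in auto)
  moreover have "sin t > 0" using assms by (intro sin_gt_zero) auto
  ultimately show ?thesis using assms by (simp add: cot_def field_simps)
qed

text \<open>
  With \<open>z n = cis (2 * pi * f n)\<close> and increments \<open>g n\<close> of \<open>f\<close> one has \<open>z n = c n * (z n - z (n + 1))\<close>
  where \<open>c n = 1 / (1 - cis (2 * pi * g n)) = 1 / 2 + \<i> / 2 * cot (pi * g n)\<close>; since \<open>g\<close> is monotone,
  the variation of \<open>c\<close> telescopes in the summation by parts.
\<close>

lemma kusmin_landau:
  fixes f :: "nat \<Rightarrow> real"
  assumes lam: "0 < lam"
    and mono: "\<And>n. l \<le> n \<Longrightarrow> Suc n < u \<Longrightarrow> f (Suc (Suc n)) - f (Suc n) \<le> f (Suc n) - f n"
    and lower: "\<And>n. l \<le> n \<Longrightarrow> n < u \<Longrightarrow> lam \<le> f (Suc n) - f n"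
    and upper: "\<And>n. l \<le> n \<Longrightarrow> n < u \<Longrightarrow> f (Suc n) - f n \<le> 1 / 2"
  shows "norm (\<Sum>n\<in>{l..<u}. cis (2 * pi * f n)) \<le> 1 / lam"
proof (cases "l < u")
  case False
  thus ?thesis using lam by simp
next
  case True
  define t where "t = (\<lambda>n. pi * (f (Suc n) - f n))"
  define z where "z = (\<lambda>n. cis (2 * pi * f n))"
  define c where "c = (\<lambda>n. Complex (1 / 2) (cot (t n) / 2))"
  have t: "0 < t n" "pi * lam \<le> t n" "t n \<le> pi / 2" if "l \<le> n" "n < u" for n
  proof -
    show *: "pi * lam \<le> t n" unfolding t_def using lower[OF that] by simp
    have "0 < pi * lam" using lam by simp
    with * show "0 < t n" by linarith
    have "pi * (f (Suc n) - f n) \<le> pi * (1 / 2)"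
      using upper[OF that] by (intro mult_left_mono) auto
    thus "t n \<le> pi / 2" by (simp add: t_def)
  qed
  have cz: "z n + c n * z (Suc n) = c n * z n" if "l \<le> n" "n < u" for n
  proof -
    have s: "sin (t n) > 0" using t[OF that] by (intro sin_gt_zero) auto
    have "z (Suc n) = z n * cis (2 * t n)"
      by (simp add: z_def t_def cis_mult algebra_simps)
    moreover have "1 + c n * cis (2 * t n) = c n"
    proof -
      define S C where "S = sin (t n)" and "C = cos (t n)"
      have S: "S > 0" and SC: "C * C = 1 - S * S"
        using s by (simp_all add: S_def C_def cos_squared_eq flip: power2_eq_square)
      have e: "cis (2 * t n) = Complex (1 - 2 * (S * S)) (2 * S * C)"
        by (simp add: complex_eq_iff S_def C_def cos_double_sin sin_double power2_eq_square)
      have "c n = Complex (1 / 2) (C / S / 2)"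
        by (simp add: c_def S_def C_def cot_def)
      moreover have "C / S / 2 * (2 * S * C) = 1 - S * S" "C / S / 2 * (2 * (S * S)) = S * C"
        using S SC by simp_all
      ultimately show ?thesis
        unfolding e by (simp add: complex_eq_iff right_diff_distrib)
    qed
    hence "z n * (1 + c n * cis (2 * t n)) = z n * c n" by simp
    ultimately show ?thesis by (simp add: algebra_simps)
  qed
  have zn: "norm (z n) = 1" for n by (simp add: z_def)
  have step: "norm ((\<Sum>n\<in>{l..<Suc m}. z n) + c m * z (Suc m)) \<le> norm (c l) + (cot (t m) - cot (t l)) / 2"
    if "l \<le> m" "m < u" for m
    using that
  proof (induction m rule: dec_induct)
    case base
    thus ?case using cz[of l] True by (simp add: norm_mult zn)
  next
    case (step m)
    have m: "l \<le> m" "m < u" "l \<le> Suc m" using step by auto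
    have "t (Suc m) \<le> t m" unfolding t_def using mono[of m] step by simp
    hence cc: "cot (t m) \<le> cot (t (Suc m))"
      using t[of "Suc m"] t[of m] m step.prems by (intro cot_antimono) auto
    have "(\<Sum>n\<in>{l..<Suc (Suc m)}. z n) + c (Suc m) * z (Suc (Suc m)) =
        ((\<Sum>n\<in>{l..<Suc m}. z n) + c m * z (Suc m)) + (c (Suc m) - c m) * z (Suc m)"
      using cz[of "Suc m"] m step.prems by (simp add: algebra_simps)
    also have "norm \<dots> \<le> norm (c l) + (cot (t m) - cot (t l)) / 2 + norm ((c (Suc m) - c m) * z (Suc m))"
      by (rule order_trans[OF norm_triangle_ineq add_right_mono[OF step.IH[OF m(2)]]])
    also have "norm ((c (Suc m) - c m) * z (Suc m)) = (cot (t (Suc m)) - cot (t m)) / 2"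
    proof -
      have "c (Suc m) - c m = \<i> * of_real ((cot (t (Suc m)) - cot (t m)) / 2)"
        by (simp add: complex_eq_iff c_def diff_divide_distrib)
      hence "norm (c (Suc m) - c m) = \<bar>(cot (t (Suc m)) - cot (t m)) / 2\<bar>"
        by (simp only: norm_mult norm_ii norm_of_real mult_1)
      thus ?thesis using cc by (simp add: norm_mult zn)
    qed
    finally show ?case by (simp add: field_simps)
  qed
  have cn: "norm (c n) \<le> 1 / 2 + cot (t n) / 2" if "l \<le> n" "n < u" for n
  proof -
    have "cot (t n) \<ge> 0"
      using t[OF that] unfolding cot_def by (intro divide_nonneg_nonneg sin_ge_zero cos_ge_zero) auto
    thus ?thesis using cmod_le[of "c n"] by (simp add: c_def)
  qed
  obtain m where u: "u = Suc m" using True by (cases u) auto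
  have m: "l \<le> m" "m < u" using True u by auto
  have "(\<Sum>n\<in>{l..<u}. z n) = ((\<Sum>n\<in>{l..<Suc m}. z n) + c m * z (Suc m)) - c m * z (Suc m)"
    by (simp add: u)
  also have "norm \<dots> \<le> norm (c l) + (cot (t m) - cot (t l)) / 2 + norm (c m)"
    by (intro norm_triangle_le_diff add_mono step m) (simp add: norm_mult zn)
  \<comment> \<open>The contributions of \<open>cot (t l)\<close> cancel between
    \<open>norm (c l)\<close> and the telescoped variation.\<close>
  also have "\<dots> \<le> 1 + cot (t m)"
    using cn[of l] cn[of m] m True by (simp add: field_simps)
  also have "cot (t m) \<le> 1 / t m" using t[of m] m by (intro cot_le_inverse) auto
  also have "1 / t m \<le> 1 / (2 * lam)"
  proof (rule divide_left_mono)
    have "2 * lam \<le> pi * lam" using lam pi_ge_two by (intro mult_right_mono) auto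
    thus "2 * lam \<le> t m" using t(2)[OF m] by linarith
    show "0 < t m * (2 * lam)" using t[of m] m lam by simp
  qed auto
  \<comment> \<open>The increments lie between \<open>lam\<close> and 1/2, so \<open>lam\<close> is
    at most 1/2 and the summand 1 is at most 1 / (2 lam).\<close>
  also have "1 + 1 / (2 * lam) \<le> 1 / lam"
    using lower[OF m] upper[OF m] lam by (simp add: field_simps)
  finally show ?thesis by (simp add: z_def)
qed

text \<open>The increments tau / (sqrt (n + 1 + s) + sqrt (n + s)) decrease. The condition on
  \<open>tau\<close> at the left end keeps them at most 1/2; at the right end they are still at
  least tau / (2 sqrt (u + s)), which serves as \<open>lam\<close>. The shift \<open>s\<close> later
  holds r / 4 for a residue r modulo 4.\<close>

lemma norm_sum_cis_sqrt_le:
  fixes tau s :: real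
  assumes tau: "0 < tau" and s: "0 \<le> s" and l: "0 < l" "tau \<le> sqrt (real l + s)"
  shows "norm (\<Sum>n\<in>{l..<u}. cis (2 * pi * (tau * sqrt (real n + s)))) \<le> 2 * sqrt (real u + s) / tau"
proof -
  have inc: "tau * sqrt (real (Suc n) + s) - tau * sqrt (real n + s) =
      tau / (sqrt (real (Suc n) + s) + sqrt (real n + s))" (is "_ = tau / ?d n") for n
  proof -
    have "?d n > 0" using s by (intro add_pos_nonneg) auto
    moreover have "(sqrt (real (Suc n) + s) - sqrt (real n + s)) * ?d n = 1"
      using s by (simp add: algebra_simps flip: power2_eq_square)
    ultimately show ?thesis by (simp add: field_simps)
  qed
  show ?thesis
  proof (cases "l < u")
    case False
    thus ?thesis using assms by simp
  next
    case True
    have u: "sqrt (real u + s) > 0" using True s by simp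
    have "norm (\<Sum>n\<in>{l..<u}. cis (2 * pi * (tau * sqrt (real n + s)))) \<le> 1 / (tau / (2 * sqrt (real u + s)))"
    proof (rule kusmin_landau)
      show "0 < tau / (2 * sqrt (real u + s))" using tau u by simp
      fix n assume n: "l \<le> n"
      have pos: "?d n > 0" for n using s by (intro add_pos_nonneg) auto
      show "tau * sqrt (real (Suc (Suc n)) + s) - tau * sqrt (real (Suc n) + s)
            \<le> tau * sqrt (real (Suc n) + s) - tau * sqrt (real n + s)"
        unfolding inc using tau pos[of n] pos[of "Suc n"]
        by (intro divide_left_mono add_mono mult_pos_pos) auto
      have "2 * tau \<le> sqrt (real n + s) + sqrt (real n + s)"
        using l(2) n by (smt (verit) of_nat_le_iff real_sqrt_le_iff)
      also have "\<dots> \<le> ?d n" by simp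
      finally show "tau * sqrt (real (Suc n) + s) - tau * sqrt (real n + s) \<le> 1 / 2"
        unfolding inc using pos[of n] by (simp add: field_simps)
      assume "n < u"
      hence "sqrt (real (Suc n) + s) \<le> sqrt (real u + s)" "sqrt (real n + s) \<le> sqrt (real u + s)" by auto
      hence "?d n \<le> 2 * sqrt (real u + s)" by linarith
      thus "tau / (2 * sqrt (real u + s)) \<le> tau * sqrt (real (Suc n) + s) - tau * sqrt (real n + s)"
        unfolding inc using tau pos[of n] u by (intro divide_left_mono mult_pos_pos) auto
    qed
    thus ?thesis by (simp add: field_simps)
  qed
qed

text \<open>An off-diagonal term after Cauchy-Schwarz. Inside a dyadic block |sqrt a - sqrt a'| is
  at most sqrt D / 2, so the frequency is at most sqrt D, hence at most sqrt l. The saving 1 / |a -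
  a'| comes from |a - a'| \<le> 3 sqrt D |sqrt a - sqrt a'|.\<close>

lemma norm_sum_cis_sqrt_diff_le:
  fixes a a' D l u :: nat and theta X :: real
  assumes D: "0 < D" and a: "a \<in> {D..<2*D}" "a' \<in> {D..<2*D}" "a \<noteq> a'"
    and theta: "1 / 2 \<le> theta" "theta \<le> 2" and l: "D \<le> l"
    and u: "real D * real u \<le> X"
  shows "norm (\<Sum>b\<in>{l..<u}. cis (2 * pi * (theta * (sqrt a - sqrt a') * sqrt b)))
           \<le> 12 * sqrt X / \<bar>real a - real a'\<bar>"
proof -
  define tau where "tau = theta * \<bar>sqrt a - sqrt a'\<bar>"
  have D': "sqrt D > 0" using D by simp
  have ne: "sqrt a \<noteq> sqrt a'" using a by simp
  have bounds: "sqrt D \<le> sqrt x" "sqrt x \<le> sqrt 2 * sqrt D" if "x \<in> {D..<2*D}" for x :: nat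
    using that by (auto simp flip: real_sqrt_mult)
  have s2: "sqrt 2 \<le> (3/2 :: real)" by (rule real_le_lsqrt) (auto simp: power2_eq_square)
  have "\<bar>sqrt a - sqrt a'\<bar> \<le> (sqrt 2 - 1) * sqrt D"
    using bounds[OF a(1)] bounds[OF a(2)] unfolding left_diff_distrib by linarith
  also have "\<dots> \<le> 1 / 2 * sqrt D" using s2 by (intro mult_right_mono) auto
  finally have "tau \<le> 2 * (1 / 2 * sqrt D)"
    unfolding tau_def using theta by (intro mult_mono) auto
  also have "\<dots> \<le> sqrt l" using l by simp
  finally have tau_le: "tau \<le> sqrt (real l + 0)" by simp
  have tau_pos: "tau > 0" using theta ne by (simp add: tau_def)
  have "\<bar>real a - real a'\<bar> = \<bar>sqrt a - sqrt a'\<bar> * (sqrt a + sqrt a')"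
  proof -
    have "real a - real a' = (sqrt a - sqrt a') * (sqrt a + sqrt a')"
      by (simp add: algebra_simps)
    thus ?thesis by (simp add: abs_mult)
  qed
  also have "\<dots> \<le> \<bar>sqrt a - sqrt a'\<bar> * (3 * sqrt D)"
  proof (rule mult_left_mono)
    have "sqrt 2 * sqrt D \<le> 3 / 2 * sqrt D" using s2 by (rule mult_right_mono) simp
    thus "sqrt a + sqrt a' \<le> 3 * sqrt D"
      using bounds[OF a(1)] bounds[OF a(2)] by linarith
  qed simp
  finally have diff: "\<bar>real a - real a'\<bar> \<le> 3 * sqrt D * \<bar>sqrt a - sqrt a'\<bar>" by (simp add: mult_ac)
  have "norm (\<Sum>b\<in>{l..<u}. cis (2 * pi * (theta * (sqrt a - sqrt a') * sqrt b))) =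
        norm (\<Sum>b\<in>{l..<u}. cis (2 * pi * (tau * sqrt (real b + 0))))"
  proof (cases "sqrt a \<ge> sqrt a'")
    case True
    thus ?thesis by (simp add: tau_def)
  next
    case False
    hence "cis (2 * pi * (theta * (sqrt a - sqrt a') * sqrt b)) =
        cnj (cis (2 * pi * (tau * sqrt (real b + 0))))" for b
      by (simp add: tau_def cis_cnj algebra_simps)
    hence "(\<Sum>b\<in>{l..<u}. cis (2 * pi * (theta * (sqrt a - sqrt a') * sqrt b))) =
        cnj (\<Sum>b\<in>{l..<u}. cis (2 * pi * (tau * sqrt (real b + 0))))"
      by (simp add: cnj_sum)
    thus ?thesis by (simp only: complex_mod_cnj)
  qed
  also have "\<dots> \<le> 2 * sqrt (real u + 0) / tau"
    by (rule norm_sum_cis_sqrt_le) (use tau_pos tau_le l D in auto)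
  also have "\<dots> \<le> 12 * sqrt X / \<bar>real a - real a'\<bar>"
  proof -
    have DuX: "sqrt D * sqrt u \<le> sqrt X" using u by (simp flip: real_sqrt_mult)
    moreover have "0 \<le> sqrt D * sqrt u" by simp
    ultimately have X: "0 \<le> sqrt X" by linarith
    have "2 * sqrt u * \<bar>real a - real a'\<bar> \<le> 2 * sqrt u * (3 * sqrt D * \<bar>sqrt a - sqrt a'\<bar>)"
      using diff by (intro mult_left_mono) auto
    also have "\<dots> = 6 * (sqrt D * sqrt u) * \<bar>sqrt a - sqrt a'\<bar>" by simp
    also have "\<dots> \<le> 6 * sqrt X * (2 * tau)"
      unfolding tau_def using DuX theta ne X
      by (intro mult_mono) (auto simp: field_simps)
    finally show ?thesis using tau_pos a(3) by (simp add: field_simps)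
  qed
  finally show ?thesis .
qed

lemma sum_inverse_dist_le:
  assumes "a \<in> {D..<2*D}"
  shows "(\<Sum>a'\<in>{D..<2*D} - {a}. 1 / \<bar>real a - real a'\<bar>) \<le> 2 * harm D"
proof -
  have *: "(\<Sum>a'\<in>S. 1 / \<bar>real a - real a'\<bar>) \<le> harm D"
    if "inj_on g S" "g ` S \<subseteq> {1..D}" "\<And>a'. a' \<in> S \<Longrightarrow> real (g a') = \<bar>real a - real a'\<bar>" for S and g :: "nat \<Rightarrow> nat"
  proof -
    have "(\<Sum>a'\<in>S. 1 / \<bar>real a - real a'\<bar>) = (\<Sum>k\<in>g ` S. 1 / real k)"
      using that by (subst sum.reindex) auto
    also have "\<dots> \<le> (\<Sum>k\<in>{1..D}. 1 / real k)"
      using that by (intro sum_mono2) auto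
    finally show ?thesis by (simp add: harm_def inverse_eq_divide)
  qed
  have eq: "{D..<2*D} - {a} = {D..<a} \<union> {a<..<2*D}" using assms by auto
  have "(\<Sum>a'\<in>{D..<2*D} - {a}. 1 / \<bar>real a - real a'\<bar>) =
      (\<Sum>a'\<in>{D..<a}. 1 / \<bar>real a - real a'\<bar>) + (\<Sum>a'\<in>{a<..<2*D}. 1 / \<bar>real a - real a'\<bar>)"
    unfolding eq by (rule sum.union_disjoint) auto
  also have "(\<Sum>a'\<in>{D..<a}. 1 / \<bar>real a - real a'\<bar>) \<le> harm D"
    by (rule *[of "\<lambda>k. a - k"]) (use assms in \<open>auto simp: inj_on_def of_nat_diff\<close>)
  also have "(\<Sum>a'\<in>{a<..<2*D}. 1 / \<bar>real a - real a'\<bar>) \<le> harm D"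
    by (rule *[of "\<lambda>k. k - a"]) (use assms in \<open>auto simp: inj_on_def of_nat_diff\<close>)
  finally show ?thesis by simp
qed

text \<open>Cauchy-Schwarz over b removes the unknown coefficients \<open>\<beta>\<close>. In the
  opened square each diagonal pair costs at most X / D, and the off-diagonal pairs sum to a harmonic
  series over the distances |a - a'|.\<close>

lemma norm_bilinear_sum_le:
  fixes \<alpha> \<beta> :: "nat \<Rightarrow> complex" and l u :: "nat \<Rightarrow> nat" and theta :: real
  assumes D: "0 < D" and theta: "1 / 2 \<le> theta" "theta \<le> 2"
    and \<alpha>: "\<And>a. a \<in> {D..<2*D} \<Longrightarrow> norm (\<alpha> a) \<le> A"
    and \<beta>: "\<And>a b. a \<in> {D..<2*D} \<Longrightarrow> b \<in> {l a..<u a} \<Longrightarrow> norm (\<beta> b) \<le> B"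
    and l: "\<And>a. a \<in> {D..<2*D} \<Longrightarrow> D \<le> l a"
    and u: "\<And>a. a \<in> {D..<2*D} \<Longrightarrow> real D * real (u a) \<le> X"
    and nonneg: "0 \<le> A" "0 \<le> B" "0 \<le> X"
  shows "(norm (\<Sum>a\<in>{D..<2*D}. \<Sum>b\<in>{l a..<u a}. \<alpha> a * \<beta> b * cis (2 * pi * (theta * sqrt (real (a * b))))))\<^sup>2
           \<le> A\<^sup>2 * B\<^sup>2 * (X\<^sup>2 / D + 24 * X * sqrt X * harm D)"
proof -
  define W where "W = {D..<2*D}"
  define M where "M = nat \<lfloor>X / D\<rfloor>"
  have M: "real M \<le> X / D" using nonneg by (simp add: M_def)
  have uM: "u a \<le> M" if "a \<in> W" for a
    using u[of a] that D by (simp add: M_def W_def le_nat_floor field_simps)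
  define R where "R = (\<lambda>a b. b \<in> {l a..<u a})"
  \<comment> \<open>The bound on \<open>\<beta>\<close> is available only at b lying in some
    interval, so it is cut to 0 elsewhere. The dependence of the intervals on a goes into
    \<open>e\<close> below, so that b can run over one common range.\<close>
  define \<gamma> where "\<gamma> = (\<lambda>b. if \<exists>a\<in>W. R a b then \<beta> b else 0)"
  have \<gamma>: "norm (\<gamma> b) \<le> B" for b
    using \<beta> nonneg unfolding \<gamma>_def R_def W_def by (cases "\<exists>a\<in>W. R a b") (auto simp: R_def W_def)
  define e where "e = (\<lambda>a b::nat. if R a b then \<alpha> a * cis (2 * pi * (theta * sqrt a * sqrt b)) else 0)"
  define G where "G = (\<lambda>b. \<Sum>a\<in>W. e a b)"
  define S where "S = (\<Sum>a\<in>W. \<Sum>b\<in>{l a..<u a}. \<alpha> a * \<beta> b * cis (2 * pi * (theta * sqrt (real (a * b)))))"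
  have "S = (\<Sum>a\<in>W. \<Sum>b<M. \<gamma> b * e a b)"
    unfolding S_def
  proof (rule sum.cong[OF refl])
    fix a assume a: "a \<in> W"
    have "(\<Sum>b\<in>{l a..<u a}. \<alpha> a * \<beta> b * cis (2 * pi * (theta * sqrt (real (a * b))))) =
          (\<Sum>b\<in>{l a..<u a}. \<gamma> b * e a b)"
      using a by (intro sum.cong) (auto simp: \<gamma>_def e_def R_def real_sqrt_mult mult_ac)
    also have "\<dots> = (\<Sum>b<M. \<gamma> b * e a b)"
      using uM[OF a] by (intro sum.mono_neutral_left) (auto simp: e_def R_def)
    finally show "(\<Sum>b\<in>{l a..<u a}. \<alpha> a * \<beta> b * cis (2 * pi * (theta * sqrt (real (a * b))))) =
        (\<Sum>b<M. \<gamma> b * e a b)" .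
  qed
  also have "\<dots> = (\<Sum>b<M. \<gamma> b * G b)"
    unfolding G_def sum_distrib_left by (rule sum.swap)
  finally have "norm S \<le> (\<Sum>b<M. norm (\<gamma> b) * norm (G b))"
    by (simp add: sum_norm_le norm_mult)
  hence "(norm S)\<^sup>2 \<le> (\<Sum>b<M. norm (\<gamma> b) * norm (G b))\<^sup>2" by (rule power_mono) auto
  also have "\<dots> \<le> (\<Sum>b<M. (norm (\<gamma> b))\<^sup>2) * (\<Sum>b<M. (norm (G b))\<^sup>2)"
    by (rule Cauchy_Schwarz_ineq_sum)
  also have "\<dots> \<le> (B\<^sup>2 * (X / D)) * (A\<^sup>2 * (X + 24 * real D * sqrt X * harm D))"
  proof (rule mult_mono)
    have "(\<Sum>b<M. (norm (\<gamma> b))\<^sup>2) \<le> (\<Sum>b<M. B\<^sup>2)"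
      using \<gamma> by (intro sum_mono power_mono) auto
    also have "\<dots> = B\<^sup>2 * M" by simp
    also have "\<dots> \<le> B\<^sup>2 * (X / D)" using M by (intro mult_left_mono) auto
    finally show "(\<Sum>b<M. (norm (\<gamma> b))\<^sup>2) \<le> B\<^sup>2 * (X / D)" .
  next
    \<comment> \<open>Two intervals meet in an interval, so every pair a, a' leaves an exponential
      sum without coefficients.\<close>
    define I where "I = (\<lambda>a a'. \<Sum>b\<in>{max (l a) (l a')..<min (u a) (u a')}. cis (2 * pi * (theta * (sqrt a - sqrt a') * sqrt b)))"
    have inner: "(\<Sum>b<M. e a b * cnj (e a' b)) = \<alpha> a * cnj (\<alpha> a') * I a a'" if "a \<in> W" "a' \<in> W" for a a'
    proof -
      have "(\<Sum>b<M. e a b * cnj (e a' b)) =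
          (\<Sum>b\<in>{max (l a) (l a')..<min (u a) (u a')}. e a b * cnj (e a' b))"
        using uM[OF that(1)] by (intro sum.mono_neutral_right) (auto simp: e_def R_def)
      also have "\<dots> = (\<Sum>b\<in>{max (l a) (l a')..<min (u a) (u a')}.
          \<alpha> a * cnj (\<alpha> a') * cis (2 * pi * (theta * (sqrt a - sqrt a') * sqrt b)))"
      proof (intro sum.cong refl)
        fix b assume b: "b \<in> {max (l a) (l a')..<min (u a) (u a')}"
        have "cis (2 * pi * (theta * sqrt a * sqrt b)) * cnj (cis (2 * pi * (theta * sqrt a' * sqrt b)))
            = cis (2 * pi * (theta * (sqrt a - sqrt a') * sqrt b))"
          by (simp add: cis_cnj cis_mult algebra_simps)
        thus "e a b * cnj (e a' b) = \<alpha> a * cnj (\<alpha> a') * cis (2 * pi * (theta * (sqrt a - sqrt a') * sqrt b))"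
          using b by (simp add: e_def R_def mult_ac)
      qed
      finally show ?thesis by (simp add: I_def sum_distrib_left)
    qed
    have "complex_of_real (\<Sum>b<M. (norm (G b))\<^sup>2) = (\<Sum>b<M. \<Sum>a\<in>W. \<Sum>a'\<in>W. e a b * cnj (e a' b))"
      unfolding of_real_sum complex_norm_square G_def cnj_sum sum_product ..
    also have "\<dots> = (\<Sum>a\<in>W. \<Sum>b<M. \<Sum>a'\<in>W. e a b * cnj (e a' b))"
      by (rule sum.swap)
    also have "\<dots> = (\<Sum>a\<in>W. \<Sum>a'\<in>W. \<Sum>b<M. e a b * cnj (e a' b))"
      by (intro sum.cong refl sum.swap)
    also have "\<dots> = (\<Sum>a\<in>W. \<Sum>a'\<in>W. \<alpha> a * cnj (\<alpha> a') * I a a')"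
      by (intro sum.cong refl inner)
    finally have "norm (complex_of_real (\<Sum>b<M. (norm (G b))\<^sup>2)) =
        norm (\<Sum>a\<in>W. \<Sum>a'\<in>W. \<alpha> a * cnj (\<alpha> a') * I a a')" by simp
    hence "(\<Sum>b<M. (norm (G b))\<^sup>2) = norm (\<Sum>a\<in>W. \<Sum>a'\<in>W. \<alpha> a * cnj (\<alpha> a') * I a a')"
      by (simp only: norm_of_real) (simp add: sum_nonneg)
    also have "\<dots> \<le> (\<Sum>a\<in>W. \<Sum>a'\<in>W. norm (\<alpha> a * cnj (\<alpha> a') * I a a'))"
      by (intro sum_norm_le order_refl)
    also have "\<dots> \<le> (\<Sum>a\<in>W. \<Sum>a'\<in>W. A\<^sup>2 * norm (I a a'))"
      using \<alpha> nonneg unfolding W_def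
      by (intro sum_mono) (auto simp: norm_mult power2_eq_square intro!: mult_mono)
    also have "\<dots> = A\<^sup>2 * (\<Sum>a\<in>W. \<Sum>a'\<in>W. norm (I a a'))"
      by (simp add: sum_distrib_left)
    also have "(\<Sum>a\<in>W. \<Sum>a'\<in>W. norm (I a a')) \<le> (\<Sum>a\<in>W. X / D + 24 * sqrt X * harm D)"
    proof (rule sum_mono)
      fix a assume a: "a \<in> W"
      have "(\<Sum>a'\<in>W. norm (I a a')) = norm (I a a) + (\<Sum>a'\<in>W - {a}. norm (I a a'))"
        using a by (intro sum.remove) (auto simp: W_def)
      also have "norm (I a a) \<le> X / D"
      proof -
        have "norm (I a a) = real (u a - l a)" by (simp add: I_def flip: of_nat_diff)
        also have "\<dots> \<le> real M" using uM[OF a] by simp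
        finally show ?thesis using M by linarith
      qed
      also have "(\<Sum>a'\<in>W - {a}. norm (I a a')) \<le> (\<Sum>a'\<in>W - {a}. 12 * sqrt X * (1 / \<bar>real a - real a'\<bar>))"
      proof (rule sum_mono)
        fix a' assume a': "a' \<in> W - {a}"
        have "real D * real (min (u a) (u a')) \<le> real D * real (u a)"
          by (intro mult_left_mono) auto
        also have "\<dots> \<le> X" using u a by (simp add: W_def)
        finally have "norm (I a a') \<le> 12 * sqrt X / \<bar>real a - real a'\<bar>"
          unfolding I_def using a a' l[of a] D theta
          by (intro norm_sum_cis_sqrt_diff_le) (auto simp: W_def)
        thus "norm (I a a') \<le> 12 * sqrt X * (1 / \<bar>real a - real a'\<bar>)" by simp
      qed
      also have "\<dots> = 12 * sqrt X * (\<Sum>a'\<in>W - {a}. 1 / \<bar>real a - real a'\<bar>)"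
        by (simp only: sum_distrib_left)
      also have "\<dots> \<le> 12 * sqrt X * (2 * harm D)"
        using sum_inverse_dist_le[of a D] a nonneg unfolding W_def by (intro mult_left_mono) auto
      finally show "(\<Sum>a'\<in>W. norm (I a a')) \<le> X / D + 24 * sqrt X * harm D" by simp
    qed
    also have "(\<Sum>a\<in>W. X / D + 24 * sqrt X * harm D) = X + 24 * real D * sqrt X * harm D"
      using D by (simp add: W_def algebra_simps)
    finally show "(\<Sum>b<M. (norm (G b))\<^sup>2) \<le> A\<^sup>2 * (X + 24 * real D * sqrt X * harm D)"
      by (simp add: mult_left_mono)
  qed (auto intro!: sum_nonneg simp: nonneg)
  also have "\<dots> = A\<^sup>2 * B\<^sup>2 * (X\<^sup>2 / D + 24 * X * sqrt X * harm D)"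
    using D by (simp add: field_simps power2_eq_square)
  finally show ?thesis unfolding S_def W_def .
qed

section \<open>The Moebius function and the hyperbola method\<close>

definition moebius_mu :: "nat \<Rightarrow> real" where
  "moebius_mu n = (if squarefree n then (-1) ^ card (prime_factors n) else 0)"

lemma abs_moebius_mu_le: "\<bar>moebius_mu n\<bar> \<le> 1"
  by (simp add: moebius_mu_def)

lemma moebius_mu_prime_mult:
  assumes "prime p" "\<not> p dvd d" "d > 0"
  shows "moebius_mu (p * d) = - moebius_mu d"
proof -
  have cop: "coprime p d" using assms by (simp add: prime_imp_coprime)
  have "squarefree (p * d) \<longleftrightarrow> squarefree d"
    using squarefree_mult_coprime[OF cop squarefree_prime[OF assms(1)]] squarefree_multD(2) by blast
  moreover have "prime_factors (p * d) = insert p (prime_factors d)"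
    using assms by (simp add: prime_factors_product prime_prime_factors)
  moreover have "p \<notin> prime_factors d" using assms by auto
  ultimately show ?thesis by (simp add: moebius_mu_def)
qed

text \<open>For a fixed prime p dividing n, the squarefree divisors pair up as d and p d with p not
  dividing d, and each pair cancels.\<close>

lemma sum_moebius_mu_divisors:
  assumes "n > 0"
  shows "(\<Sum>d | d dvd n. moebius_mu d) = (if n = 1 then 1 else 0)"
proof (cases "n = 1")
  case True
  thus ?thesis by (simp add: moebius_mu_def)
next
  case False
  then obtain p where p: "prime p" "p dvd n" using prime_factor_nat by blast
  have fin: "finite {d. d dvd n}" using assms by simp
  define A where "A = {d. d dvd n \<and> squarefree d \<and> \<not> p dvd d}"
  have A: "finite A" using fin by (auto simp: A_def)
  have inj: "inj_on ((*) p) A" using p by (auto simp: inj_on_def prime_gt_0_nat)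
  have eq: "{d. d dvd n \<and> squarefree d} = A \<union> (*) p ` A"
  proof (intro equalityI subsetI)
    fix d assume d: "d \<in> {d. d dvd n \<and> squarefree d}"
    show "d \<in> A \<union> (*) p ` A"
    proof (cases "p dvd d")
      case True
      then obtain e where e: "d = p * e" by (rule dvdE)
      have "\<not> p dvd e"
      proof
        assume "p dvd e"
        hence "p ^ 2 dvd d" unfolding e power2_eq_square by (intro mult_dvd_mono dvd_refl)
        thus False using d p(1) squarefreeD[of d p] by auto
      qed
      moreover have "e dvd n" using d e by (auto dest: dvd_mult_right)
      ultimately show ?thesis using d e by (auto simp: A_def dest: squarefree_multD(2))
    qed (use d in \<open>auto simp: A_def\<close>)
  next
    fix d assume "d \<in> A \<union> (*) p ` A"
    thus "d \<in> {d. d dvd n \<and> squarefree d}"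
    proof
      assume "d \<in> (*) p ` A"
      then obtain e where e: "d = p * e" "e \<in> A" by auto
      have "coprime p e" using e p by (auto simp: A_def prime_imp_coprime)
      thus ?thesis using e p
        by (auto simp: A_def divides_mult squarefree_mult_coprime squarefree_prime)
    qed (auto simp: A_def)
  qed
  have "(\<Sum>d | d dvd n. moebius_mu d) = (\<Sum>d | d dvd n \<and> squarefree d. moebius_mu d)"
    using fin by (intro sum.mono_neutral_right) (auto simp: moebius_mu_def)
  also have "\<dots> = (\<Sum>d\<in>A. moebius_mu d) + (\<Sum>d\<in>(*) p ` A. moebius_mu d)"
    unfolding eq using A by (intro sum.union_disjoint) (auto simp: A_def)
  also have "(\<Sum>d\<in>(*) p ` A. moebius_mu d) = (\<Sum>d\<in>A. moebius_mu (p * d))"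
    by (simp add: sum.reindex[OF inj])
  also have "\<dots> = (\<Sum>d\<in>A. - moebius_mu d)"
    using p assms by (intro sum.cong moebius_mu_prime_mult) (auto simp: A_def dvd_pos_nat)
  finally show ?thesis using False by (simp add: sum_negf)
qed

text \<open>Moebius inversion: after exchanging the two divisor sums, the inner sum of
  \<open>moebius_mu\<close> runs over the divisors of n / k and leaves only k = n.\<close>

lemma sum_moebius_mu_divisor_sum:
  fixes f :: "nat \<Rightarrow> real"
  assumes "n > 0"
  shows "(\<Sum>d | d dvd n. moebius_mu d * (\<Sum>k | k dvd n div d. f k)) = f n"
proof -
  have fin: "finite {d. d dvd n}" using assms by simp
  have "(\<Sum>d | d dvd n. moebius_mu d * (\<Sum>k | k dvd n div d. f k)) =
      (\<Sum>d | d dvd n. \<Sum>k | k dvd n. if d dvd n div k then moebius_mu d * f k else 0)"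
  proof (intro sum.cong refl)
    fix d assume "d \<in> {d. d dvd n}"
    hence d: "d dvd n" by simp
    hence "d > 0" using assms by (auto simp: dvd_pos_nat)
    have iff: "k dvd n \<and> d dvd n div k \<longleftrightarrow> k dvd n div d" for k
    proof -
      obtain e where e: "n = d * e" using d by (rule dvdE)
      have "e > 0" using e assms by (cases e) auto
      show ?thesis
      proof
        assume k: "k dvd n \<and> d dvd n div k"
        then obtain m where m: "n = k * m" by (auto elim: dvdE)
        have "k > 0" using m assms by (cases k) auto
        then obtain r where r: "m = d * r" using k m by (auto elim: dvdE)
        have "d * e = d * (k * r)" using e m r mult.left_commute[of d k r] by metis
        hence "e = k * r" using \<open>d > 0\<close> by simp
        thus "k dvd n div d" using \<open>d > 0\<close> unfolding e by simp
      next
        assume "k dvd n div d"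
        then obtain r where r: "e = k * r" using e \<open>d > 0\<close> by (auto elim: dvdE)
        hence "k > 0" using \<open>e > 0\<close> by (cases k) auto
        thus "k dvd n \<and> d dvd n div k" using e r by (simp add: mult.left_commute)
      qed
    qed
    have "(\<Sum>k | k dvd n. if d dvd n div k then moebius_mu d * f k else 0) =
        (\<Sum>k | k dvd n \<and> d dvd n div k. moebius_mu d * f k)"
      using sum.inter_filter[OF fin, of "\<lambda>k. moebius_mu d * f k" "\<lambda>k. d dvd n div k"] by simp
    also have "\<dots> = (\<Sum>k | k dvd n div d. moebius_mu d * f k)" unfolding iff ..
    finally show "moebius_mu d * (\<Sum>k | k dvd n div d. f k) =
        (\<Sum>k | k dvd n. if d dvd n div k then moebius_mu d * f k else 0)"
      by (simp add: sum_distrib_left)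
  qed
  also have "\<dots> = (\<Sum>k | k dvd n. \<Sum>d | d dvd n. if d dvd n div k then moebius_mu d * f k else 0)"
    by (rule sum.swap)
  also have "\<dots> = (\<Sum>k | k dvd n. if k = n then f k else 0)"
  proof (intro sum.cong refl)
    fix k assume "k \<in> {k. k dvd n}"
    hence k: "k dvd n" by simp
    hence pos: "n div k > 0" "k > 0" using assms by (auto simp: dvd_pos_nat dvd_div_eq_0_iff elim!: dvdE)
    have "(\<Sum>d | d dvd n. if d dvd n div k then moebius_mu d * f k else 0) =
        (\<Sum>d | d dvd n div k. if d dvd n div k then moebius_mu d * f k else 0)"
    proof (rule sum.mono_neutral_right)
      show "{d. d dvd n div k} \<subseteq> {d. d dvd n}"
        using dvd_mult2[of _ "n div k" k] k by auto
    qed (use fin in auto)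
    also have "\<dots> = (\<Sum>d | d dvd n div k. moebius_mu d) * f k"
      by (simp add: sum_distrib_right)
    also have "\<dots> = (if n div k = 1 then f k else 0)"
      using sum_moebius_mu_divisors[OF pos(1)] by simp
    also have "n div k = 1 \<longleftrightarrow> k = n" using k assms pos by (auto elim!: dvdE)
    finally show "(\<Sum>d | d dvd n. if d dvd n div k then moebius_mu d * f k else 0) = (if k = n then f k else 0)" .
  qed
  also have "\<dots> = f n" using fin by simp
  finally show ?thesis .
qed

lemma sum_hyperbola:
  fixes f :: "nat \<Rightarrow> nat \<Rightarrow> 'a :: comm_monoid_add"
  shows "(\<Sum>n\<in>{1..x}. \<Sum>d | d dvd n. f d (n div d)) = (\<Sum>d\<in>{1..x}. \<Sum>m\<in>{1..x div d}. f d m)"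
proof -
  have "(\<Sum>n\<in>{1..x}. \<Sum>d | d dvd n. f d (n div d)) =
        (\<Sum>(n, d)\<in>(SIGMA n:{1..x}. {d. d dvd n}). f d (n div d))"
    by (rule sum.Sigma) auto
  also have "\<dots> = (\<Sum>(d, m)\<in>(SIGMA d:{1..x}. {1..x div d}). f d m)"
  proof (rule sum.reindex_bij_witness[of _ "\<lambda>(d, m). (d * m, d)" "\<lambda>(n, d). (d, n div d)"])
    fix a assume a: "a \<in> (SIGMA n:{1..x}. {d. d dvd n})"
    obtain n d where nd: "a = (n, d)" "1 \<le> n" "n \<le> x" "d dvd n" using a by auto
    have "d \<le> n" "n div d > 0" "d > 0" using nd by (auto intro: dvd_imp_le simp: dvd_pos_nat elim!: dvdE)
    thus "(case a of (n, d) \<Rightarrow> (d, n div d)) \<in> (SIGMA d:{1..x}. {1..x div d})"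
      using nd by (auto simp: div_le_mono Suc_le_eq)
  next
    fix b assume b: "b \<in> (SIGMA d:{1..x}. {1..x div d})"
    obtain d m where dm: "b = (d, m)" "1 \<le> d" "d \<le> x" "1 \<le> m" "m \<le> x div d" using b by auto
    thus "(case b of (d, m) \<Rightarrow> (d * m, d)) \<in> (SIGMA n:{1..x}. {d. d dvd n})"
      by (auto simp: less_eq_div_iff_mult_less_eq mult.commute Suc_le_eq)
  qed auto
  also have "\<dots> = (\<Sum>d\<in>{1..x}. \<Sum>m\<in>{1..x div d}. f d m)"
    by (rule sum.Sigma[symmetric]) auto
  finally show ?thesis .
qed

section \<open>Type I sums and dyadic bilinear sums\<close>

text \<open>The quotient \<open>(N + 3 - r) div 4\<close> is the ceiling of (N - r) / 4, the number
  of j with 4 j + r < N; since r < 4, the subtraction does not truncate.\<close>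

lemma sum_residues_4:
  fixes g :: "nat \<Rightarrow> 'a :: comm_monoid_add"
  shows "(\<Sum>b<N. g b) = (\<Sum>r<4. \<Sum>j<(N + 3 - r) div 4. g (4 * j + r))"
proof -
  have *: "b div 4 < (N + 3 - b mod 4) div 4" if "b < N" for b
  proof -
    obtain q r where qr: "b div 4 = q" "b mod 4 = r" by simp
    hence "q * 4 + r < N" using that div_mult_mod_eq[of b 4] by simp
    hence "Suc (b div 4) * 4 \<le> N + 3 - b mod 4" unfolding qr by simp
    hence "Suc (b div 4) \<le> (N + 3 - b mod 4) div 4"
      by (subst less_eq_div_iff_mult_less_eq) auto
    thus ?thesis by simp
  qed
  have "(\<Sum>r<4. \<Sum>j<(N + 3 - r) div 4. g (4 * j + r)) =
      (\<Sum>(r, j)\<in>(SIGMA r:{..<4}. {..<(N + 3 - r) div 4}). g (4 * j + r))"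
    by (rule sum.Sigma) auto
  also have "\<dots> = (\<Sum>b<N. g b)"
    by (rule sum.reindex_bij_witness[of _ "\<lambda>b. (b mod 4, b div 4)" "\<lambda>(r, j). 4 * j + r"])
      (auto intro: *)
  finally show ?thesis ..
qed

text \<open>On a residue class modulo 4 the character is constant and the phase is tau sqrt (j + r /
  4) with tau = 2 theta sqrt a at most sqrt (16 a). The terms with j < 16 a are counted trivially;
  beyond them the increments are at most 1/2. The four classes together give 4 (16 a + 2 sqrt
  N).\<close>

lemma norm_sum_char_cis_sqrt_le:
  fixes chi :: "nat \<Rightarrow> real" and theta :: real
  assumes per: "\<And>n. chi (n + 4) = chi n" and chi: "\<And>n. \<bar>chi n\<bar> \<le> 1"
    and theta: "1 / 2 \<le> theta" "theta \<le> 2" and a: "1 \<le> a"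
  shows "norm (\<Sum>b<N. chi b * cis (2 * pi * (theta * sqrt (real (a * b))))) \<le> 64 * real a + 8 * sqrt N"
proof -
  define tau where "tau = 2 * theta * sqrt a"
  have tau1: "1 \<le> tau"
    using mult_mono[of 1 "2 * theta" 1 "sqrt a"] theta a by (simp add: tau_def)
  have tau2: "tau \<le> sqrt (16 * a)"
    using mult_right_mono[of "2 * theta" 4 "sqrt a"] theta by (simp add: tau_def real_sqrt_mult)
  have per': "chi (4 * j + r) = chi r" for j r
  proof (induction j)
    case (Suc j)
    show ?case using per[of "4 * j + r"] Suc by (simp add: add_ac)
  qed simp
  have block: "norm (\<Sum>j<J. chi (4 * j + r) * cis (2 * pi * (theta * sqrt (real (a * (4 * j + r))))))
      \<le> 16 * real a + 2 * sqrt N" if r: "r < 4" and J: "J = (N + 3 - r) div 4" for r J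
  proof -
    have phase: "theta * sqrt (real (a * (4 * j + r))) = tau * sqrt (real j + r / 4)" for j
    proof -
      have "real (a * (4 * j + r)) = a * (4 * (real j + r / 4))" by simp
      thus ?thesis by (simp only: real_sqrt_mult tau_def) simp
    qed
    define z where "z = (\<lambda>j. cis (2 * pi * (tau * sqrt (real j + r / 4))))"
    have "norm (\<Sum>j<J. z j) \<le> 16 * real a + 2 * sqrt N"
    proof (cases "J \<le> 16 * a")
      case True
      have "norm (\<Sum>j<J. z j) \<le> (\<Sum>j<J. norm (z j))" by (rule norm_sum)
      also have "\<dots> = J" by (simp add: z_def)
      also have "real J \<le> 16 * real a" using True by linarith
      also have "\<dots> \<le> 16 * real a + 2 * sqrt N" by simp
      finally show ?thesis .
    next
      case False
      have "(\<Sum>j<J. z j) = (\<Sum>j<16 * a. z j) + (\<Sum>j\<in>{16 * a..<J}. z j)"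
        using False by (simp add: lessThan_atLeast0 sum.atLeastLessThan_concat)
      also have "norm \<dots> \<le> norm (\<Sum>j<16 * a. z j) + norm (\<Sum>j\<in>{16 * a..<J}. z j)"
        by (rule norm_triangle_ineq)
      also have "norm (\<Sum>j<16 * a. z j) \<le> (\<Sum>j<16 * a. norm (z j))" by (rule norm_sum)
      also have "\<dots> = 16 * a" by (simp add: z_def)
      also have "norm (\<Sum>j\<in>{16 * a..<J}. z j) \<le> 2 * sqrt (real J + r / 4) / tau"
        unfolding z_def
      proof (rule norm_sum_cis_sqrt_le)
        show "tau \<le> sqrt (real (16 * a) + real r / 4)"
          by (rule order_trans[OF tau2]) simp
      qed (use tau1 a in auto)
      also have "\<dots> \<le> 2 * sqrt N / 1"
      proof (intro frac_le mult_left_mono)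
        have "4 * J + r \<le> N + 3" "N \<ge> 1" using J r False by auto
        hence "real J + r / 4 \<le> real N" by simp
        thus "sqrt (real J + r / 4) \<le> sqrt N" by simp
      qed (use tau1 in auto)
      finally show ?thesis by simp
    qed
    moreover have "(\<Sum>j<J. chi (4 * j + r) * cis (2 * pi * (theta * sqrt (real (a * (4 * j + r)))))) =
        chi r * (\<Sum>j<J. z j)"
      by (simp only: per' phase z_def sum_distrib_left)
    moreover have "norm (chi r * (\<Sum>j<J. z j)) \<le> 1 * (16 * real a + 2 * sqrt N)"
      unfolding norm_mult norm_of_real using chi calculation(1) by (intro mult_mono) auto
    ultimately show ?thesis by (simp only: mult_1)
  qed
  have "norm (\<Sum>b<N. chi b * cis (2 * pi * (theta * sqrt (real (a * b))))) \<le> (\<Sum>r<4::nat. 16 * real a + 2 * sqrt N)"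
    unfolding sum_residues_4[of _ N] by (intro sum_norm_le block[OF _ refl]) simp
  also have "\<dots> = 64 * real a + 8 * sqrt N" by simp
  finally show ?thesis .
qed

text \<open>Summation by parts: the total variation of a monotone weight is
  \<open>w N - w 0\<close>. It serves to remove the factor ln m from a type I sum.\<close>

lemma norm_sum_monotone_weight_le:
  fixes w :: "nat \<Rightarrow> real" and g :: "nat \<Rightarrow> complex"
  assumes w: "mono w" "0 \<le> w 0" and K: "\<And>M. M \<le> N \<Longrightarrow> norm (\<Sum>b<M. g b) \<le> K"
  shows "norm (\<Sum>b<N. w b * g b) \<le> 2 * w N * K"
proof -
  define G where "G = (\<lambda>M. \<Sum>b<M. g b)"
  have mono: "w m \<le> w n" if "m \<le> n" for m n using w(1) that by (auto simp: mono_def)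
  have G: "norm (G M) \<le> K" if "M \<le> N" for M using K[OF that] by (simp add: G_def)
  have K0: "K \<ge> 0" using K[of 0] by simp
  have "norm (of_real (w M) * G M - (\<Sum>b<M. w b * g b)) \<le> (w M - w 0) * K" if "M \<le> N" for M
    using that
  proof (induction M)
    case (Suc M)
    have "of_real (w (Suc M)) * G (Suc M) - (\<Sum>b<Suc M. w b * g b) =
       (of_real (w M) * G M - (\<Sum>b<M. w b * g b)) + of_real (w (Suc M) - w M) * G (Suc M)"
      by (simp add: G_def algebra_simps)
    also have "norm \<dots> \<le> (w M - w 0) * K + (w (Suc M) - w M) * K"
    proof (intro norm_triangle_le add_mono)
      show "norm (of_real (w M) * G M - (\<Sum>b<M. w b * g b)) \<le> (w M - w 0) * K"
        using Suc by simp
      have "norm (of_real (w (Suc M) - w M) * G (Suc M)) = (w (Suc M) - w M) * norm (G (Suc M))"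
        using mono[of M "Suc M"] by (simp only: norm_mult norm_of_real) simp
      also have "\<dots> \<le> (w (Suc M) - w M) * K"
        using G[OF Suc.prems] mono[of M "Suc M"] by (intro mult_left_mono) auto
      finally show "norm (of_real (w (Suc M) - w M) * G (Suc M)) \<le> (w (Suc M) - w M) * K" .
    qed
    finally show ?case by (simp add: algebra_simps)
  qed (simp add: G_def)
  from this[of N] have 1: "norm (of_real (w N) * G N - (\<Sum>b<N. w b * g b)) \<le> (w N - w 0) * K" by simp
  have "w N \<ge> 0" using w mono[of 0 N] by linarith
  have "(\<Sum>b<N. w b * g b) = of_real (w N) * G N - (of_real (w N) * G N - (\<Sum>b<N. w b * g b))" by simp
  also have "norm \<dots> \<le> w N * K + (w N - w 0) * K"
    using G[of N] \<open>w N \<ge> 0\<close>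
    by (intro norm_triangle_le_diff add_mono 1) (simp add: norm_mult mult_left_mono)
  also have "\<dots> \<le> 2 * w N * K" using w(2) K0 by (simp add: algebra_simps)
  finally show ?thesis .
qed

text \<open>The condition \<open>a \<le> l a\<close> says that the inner variable is the larger one,
  which on the block from D gives the lower limit D needed there. Every block receives the bound of
  the worst case, with X^2 / U for X^2 / D and H for the harmonic number, whence the factor
  J.\<close>

lemma norm_bilinear_sum_dyadic_le:
  fixes \<alpha> \<beta> :: "nat \<Rightarrow> complex" and l u :: "nat \<Rightarrow> nat" and theta :: real
  assumes U: "0 < U" and theta: "1 / 2 \<le> theta" "theta \<le> 2"
    and \<alpha>: "\<And>a. a \<in> {U..<U * 2 ^ J} \<Longrightarrow> norm (\<alpha> a) \<le> A"
    and \<beta>: "\<And>a b. a \<in> {U..<U * 2 ^ J} \<Longrightarrow> b \<in> {l a..<u a} \<Longrightarrow> norm (\<beta> b) \<le> B"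
    and l: "\<And>a. a \<in> {U..<U * 2 ^ J} \<Longrightarrow> a \<le> l a"
    and u: "\<And>a. a \<in> {U..<U * 2 ^ J} \<Longrightarrow> real a * real (u a) \<le> X"
    and nonneg: "0 \<le> A" "0 \<le> B" "0 \<le> X" and H: "harm (U * 2 ^ J) \<le> H"
  shows "norm (\<Sum>a\<in>{U..<U * 2 ^ J}. \<Sum>b\<in>{l a..<u a}. \<alpha> a * \<beta> b * cis (2 * pi * (theta * sqrt (real (a * b)))))
           \<le> J * (A * B * sqrt (X\<^sup>2 / U + 24 * X * sqrt X * H))"
proof -
  define f where "f = (\<lambda>a. \<Sum>b\<in>{l a..<u a}. \<alpha> a * \<beta> b * cis (2 * pi * (theta * sqrt (real (a * b)))))"
  define C where "C = A * B * sqrt (X\<^sup>2 / U + 24 * X * sqrt X * H)"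
  have "norm (\<Sum>a\<in>{U..<U * 2 ^ j}. f a) \<le> j * C" if "j \<le> J" for j
    using that
  proof (induction j)
    case (Suc j)
    define D where "D = U * 2 ^ j"
    have D: "U \<le> D" "0 < D" using U by (auto simp: D_def)
    have "2 ^ Suc j \<le> (2 ^ J :: nat)" using Suc.prems by (intro power_increasing) auto
    hence "U * 2 ^ Suc j \<le> U * 2 ^ J" by (intro mult_left_mono) auto
    hence D2: "2 * D \<le> U * 2 ^ J" by (simp add: D_def)
    hence sub: "{D..<2*D} \<subseteq> {U..<U * 2 ^ J}" using D by auto
    have "(norm (\<Sum>a\<in>{D..<2*D}. f a))\<^sup>2 \<le> A\<^sup>2 * B\<^sup>2 * (X\<^sup>2 / D + 24 * X * sqrt X * harm D)"
      unfolding f_def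
    proof (rule norm_bilinear_sum_le)
      fix a assume a: "a \<in> {D..<2*D}"
      hence a': "a \<in> {U..<U * 2 ^ J}" using sub by blast
      show "norm (\<alpha> a) \<le> A" "D \<le> l a" using \<alpha>[OF a'] l[OF a'] a by auto
      have "real D * real (u a) \<le> real a * real (u a)" using a by (intro mult_right_mono) auto
      thus "real D * real (u a) \<le> X" using u[OF a'] by linarith
      show "norm (\<beta> b) \<le> B" if "b \<in> {l a..<u a}" for b using \<beta>[OF a' that] .
    qed (use D theta nonneg in auto)
    also have "\<dots> \<le> A\<^sup>2 * B\<^sup>2 * (X\<^sup>2 / U + 24 * X * sqrt X * H)"
    proof (intro mult_left_mono add_mono divide_left_mono)
      have "harm D \<le> (harm (U * 2 ^ J) :: real)" using D2 by (intro harm_mono) auto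
      thus "harm D \<le> H" using H by linarith
    qed (use D U nonneg in auto)
    also have "\<dots> = C\<^sup>2"
    proof -
      have "H \<ge> 0" using H harm_nonneg[of "U * 2 ^ J", where ?'a = real] by linarith
      thus ?thesis using nonneg by (simp add: C_def power_mult_distrib)
    qed
    finally have "norm (\<Sum>a\<in>{D..<2*D}. f a) \<le> C"
      by (rule power2_le_imp_le) (use nonneg H harm_nonneg[of "U * 2 ^ J", where ?'a = real] in \<open>auto simp: C_def intro!: mult_nonneg_nonneg add_nonneg_nonneg\<close>)
    moreover have "(\<Sum>a\<in>{U..<U * 2 ^ Suc j}. f a) = (\<Sum>a\<in>{U..<D}. f a) + (\<Sum>a\<in>{D..<2*D}. f a)"
      using D by (subst sum.atLeastLessThan_concat) (auto simp: D_def mult_ac)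
    moreover have "norm (\<Sum>a\<in>{U..<D}. f a) \<le> j * C" using Suc by (simp add: D_def)
    ultimately show ?case
      using norm_triangle_ineq[of "\<Sum>a\<in>{U..<D}. f a" "\<Sum>a\<in>{D..<2*D}. f a"]
      by (simp add: algebra_simps)
  qed simp
  thus ?thesis by (simp add: f_def C_def)
qed

section \<open>Exponential sums over the von Mangoldt function\<close>

lemma harm_le_1_plus_ln:
  assumes "n > 0"
  shows "harm n \<le> 1 + ln (real n)"
proof -
  obtain m where n: "n = Suc m" using assms by (cases n) auto
  have "harm (Suc m) - ln (real (Suc m)) \<le> harm (Suc 0) - ln (real (Suc 0))"
    using decseq_harm_diff_ln by (rule decseqD) simp
  thus ?thesis by (simp add: n harm_expand)
qed

text \<open>
  Vaughan's identity with both parameters \<open>U\<close>: writing \<open>B m\<close> for the sum of \<open>\<Lambda>(k)\<close> over the divisors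
  \<open>k > U\<close> of \<open>m\<close>, the part of \<open>\<Lambda>\<close> beyond \<open>U\<close> is the Dirichlet convolution of \<open>\<mu>\<close> and \<open>B\<close>. The terms
  with \<open>d \<le> U\<close> are type I sums; as \<open>B\<close> vanishes up to \<open>U\<close>, the others are bilinear with both variables
  above \<open>U\<close>, and are split at the diagonal so that the inner variable is the larger one.
\<close>

lemma norm_sum_mangoldt_char_le:
  fixes chi :: "nat \<Rightarrow> real" and theta H L :: real and x U J :: nat
  assumes per: "\<And>n. chi (n + 4) = chi n" and chi: "\<And>n. \<bar>chi n\<bar> \<le> 1" and chi0: "chi 0 = 0"
    and mult: "\<And>m n. chi (m * n) = chi m * chi n"
    and theta: "1 / 2 \<le> theta" "theta \<le> 2"
    and U: "1 \<le> U" and x: "1 \<le> x" "x < U * 2 ^ J" and H: "harm (U * 2 ^ J) \<le> H"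
  defines "L \<equiv> ln (real (2 * x))"
  shows "norm (\<Sum>n\<in>{1..x}. of_real (mangoldt n * chi n) * cis (2 * pi * (theta * sqrt (real n))))
     \<le> U * L + U * (2 * L * (64 * U + 8 * sqrt (2 * real x)) + U * L * (64 * (U * U) + 8 * sqrt (2 * real x)))
        + 2 * (J * (L * sqrt ((2 * real x)\<^sup>2 / U + 24 * (2 * real x) * sqrt (2 * real x) * H)))"
proof -
  define F where "F = (\<lambda>n. of_real (chi n) * cis (2 * pi * (theta * sqrt (real n))))"
  define Lam1 Lam2 :: "nat \<Rightarrow> real"
    where "Lam1 = (\<lambda>n. if n \<le> U then mangoldt n else 0)" and "Lam2 = (\<lambda>n. if n \<le> U then 0 else mangoldt n)"
  define B where "B = (\<lambda>m. \<Sum>k | k dvd m. Lam2 k)"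
  define K where "K = 8 * sqrt (2 * real x)"
  define E where "E = J * (L * sqrt ((2 * real x)\<^sup>2 / U + 24 * (2 * real x) * sqrt (2 * real x) * H))"
  have ln_le: "ln (real n) \<le> L" if "n \<le> 2 * x" for n
    using that x unfolding L_def by (cases "n = 0") auto
  have L0: "0 \<le> L" using x by (simp add: L_def)
  have Lam: "mangoldt n = Lam1 n + Lam2 n" for n by (simp add: Lam1_def Lam2_def)
  have man_le: "mangoldt n \<le> L" if "1 \<le> n" "n \<le> x" for n
    using mangoldt_le[of n] ln_le[of n] that by linarith
  have F_norm: "norm (F n) \<le> 1" for n using chi by (simp add: F_def norm_mult)
  have F0: "F 0 = 0" by (simp add: F_def chi0)
  have B_nonneg: "B m \<ge> 0" for m
    unfolding B_def by (intro sum_nonneg) (auto simp: Lam2_def mangoldt_nonneg)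
  have B_eq: "B m = ln m - (\<Sum>k | k dvd m. Lam1 k)" if "m > 0" for m
    using mangoldt_sum[of m, where ?'a = real] that unfolding B_def Lam sum.distrib by simp
  have B_le: "B m \<le> ln m" if "m > 0" for m
    using that by (simp add: B_eq sum_nonneg Lam1_def mangoldt_nonneg)
  have B_0: "B m = 0" if "m \<le> U" "m > 0" for m
    unfolding B_def by (intro sum.neutral) (use that in \<open>auto simp: Lam2_def dest: dvd_imp_le\<close>)

  have typeI: "norm (\<Sum>b<N. F (a * b)) \<le> 64 * real a + 8 * sqrt N" if "a \<ge> 1" for a N
  proof -
    have "(\<Sum>b<N. F (a * b)) = of_real (chi a) * (\<Sum>b<N. chi b * cis (2 * pi * (theta * sqrt (real (a * b)))))"
      by (simp add: F_def mult sum_distrib_left mult_ac)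
    also have "norm \<dots> \<le> 1 * (64 * real a + 8 * sqrt N)"
      unfolding norm_mult norm_of_real
      using per chi theta that by (intro mult_mono norm_sum_char_cis_sqrt_le) auto
    finally show ?thesis by simp
  qed
  \<comment> \<open>Because \<open>chi 0 = 0\<close>, a term at 0 can be added, which turns the
    ranges of divisor sums into the initial segments of the type I bounds.\<close>
  have shift: "(\<Sum>m\<in>{1..y}. g m) = (\<Sum>m<Suc y. g m)" if "g 0 = 0" for y and g :: "nat \<Rightarrow> complex"
    using that by (intro sum.mono_neutral_left) (auto simp: not_le Suc_le_eq)
  have sqrt_le: "8 * sqrt (Suc (x div d)) \<le> K" for d
  proof -
    have "x div d \<le> x" by simp
    hence "real (Suc (x div d)) \<le> 2 * real x" using x by linarith
    thus ?thesis unfolding K_def by simp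
  qed

  \<comment> \<open>Here B m = ln m minus the sum of \<Lambda>(k) over k | m with k at most U. The
    logarithm is a monotone weight; opening the second part gives type I sums with leading factor d
    k at most U^2.\<close>
  have small: "norm (\<Sum>m\<in>{1..x div d}. B m * F (d * m)) \<le> 2 * L * (64 * U + K) + U * L * (64 * (U * U) + K)"
    if d: "d \<in> {1..U}" for d
  proof -
    define y where "y = x div d"
    have y: "y \<le> x" by (simp add: y_def)
    have "(\<Sum>m\<in>{1..y}. B m * F (d * m)) =
        (\<Sum>m\<in>{1..y}. ln m * F (d * m)) - (\<Sum>m\<in>{1..y}. (\<Sum>k | k dvd m. Lam1 k) * F (d * m))"
      unfolding sum_subtractf[symmetric]
      by (intro sum.cong refl) (simp add: B_eq algebra_simps)
    also have "norm \<dots> \<le> 2 * L * (64 * U + K) + U * L * (64 * (U * U) + K)"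
    proof (intro norm_triangle_le_diff add_mono)
      have "norm (\<Sum>m<Suc y. ln (real m) * F (d * m)) \<le> 2 * ln (real (Suc y)) * (64 * U + K)"
      proof (rule norm_sum_monotone_weight_le)
        show "mono (\<lambda>m. ln (real m))"
        proof (rule monoI)
          fix m n :: nat assume "m \<le> n"
          thus "ln (real m) \<le> ln (real n)" by (cases "m = 0"; cases "n = 0") auto
        qed
        fix M assume M: "M \<le> Suc y"
        have "norm (\<Sum>b<M. F (d * b)) \<le> 64 * real d + 8 * sqrt M" using d by (intro typeI) auto
        also have "\<dots> \<le> 64 * U + K"
        proof (intro add_mono)
          have "8 * sqrt M \<le> 8 * sqrt (Suc y)" using M by simp
          thus "8 * sqrt M \<le> K" using sqrt_le[of d] unfolding y_def by linarith
        qed (use d in auto)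
        finally show "norm (\<Sum>b<M. F (d * b)) \<le> 64 * U + K" .
      qed simp
      also have "\<dots> \<le> 2 * L * (64 * U + K)"
        using ln_le[of "Suc y"] y x by (intro mult_right_mono mult_left_mono) (auto simp: K_def)
      finally show "norm (\<Sum>m\<in>{1..y}. ln (real m) * F (d * m)) \<le> 2 * L * (64 * U + K)"
        by (subst shift) (auto simp: F0)
    next
      have "(\<Sum>m\<in>{1..y}. (\<Sum>k | k dvd m. Lam1 k) * F (d * m)) =
          (\<Sum>m\<in>{1..y}. \<Sum>k | k dvd m. of_real (Lam1 k) * F (d * (k * (m div k))))"
        unfolding of_real_sum sum_distrib_right by (intro sum.cong refl) simp
      also have "\<dots> = (\<Sum>k\<in>{1..y}. \<Sum>m\<in>{1..y div k}. of_real (Lam1 k) * F (d * (k * m)))"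
        by (rule sum_hyperbola)
      also have "\<dots> = (\<Sum>k\<in>{1..y}. of_real (Lam1 k) * (\<Sum>m<Suc (y div k). F (d * k * m)))"
        unfolding sum_distrib_left
        by (rule sum.cong[OF refl], subst shift) (auto simp: F0 mult.assoc)
      also have "\<dots> = (\<Sum>k\<in>{1..min y U}. of_real (Lam1 k) * (\<Sum>m<Suc (y div k). F (d * k * m)))"
        by (intro sum.mono_neutral_right) (auto simp: Lam1_def)
      also have "norm \<dots> \<le> (\<Sum>k\<in>{1..min y U}. L * (64 * (U * U) + K))"
      proof (rule sum_norm_le)
        fix k assume k: "k \<in> {1..min y U}"
        have "norm (\<Sum>m<Suc (y div k). F (d * k * m)) \<le> 64 * real (d * k) + 8 * sqrt (Suc (y div k))"
          using d k by (intro typeI) auto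
        also have "\<dots> \<le> 64 * (U * U) + K"
        proof (intro add_mono)
          have "d * k \<le> U * U" using d k by (intro mult_mono) auto
          thus "64 * real (d * k) \<le> 64 * (U * U)" by linarith
          show "8 * sqrt (Suc (y div k)) \<le> K"
            using sqrt_le[of "d * k"] by (simp add: y_def div_mult2_eq)
        qed
        finally have 1: "norm (\<Sum>m<Suc (y div k). F (d * k * m)) \<le> 64 * (U * U) + K" .
        have "\<bar>Lam1 k\<bar> \<le> L" using man_le[of k] k y L0 by (auto simp: Lam1_def)
        thus "norm (of_real (Lam1 k) * (\<Sum>m<Suc (y div k). F (d * k * m))) \<le> L * (64 * (U * U) + K)"
          unfolding norm_mult norm_of_real using 1 L0 by (intro mult_mono) auto
      qed
      also have "\<dots> = real (min y U) * (L * (64 * (U * U) + K))" by simp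
      also have "\<dots> \<le> U * (L * (64 * (U * U) + K))"
        using L0 by (intro mult_right_mono mult_nonneg_nonneg) (auto simp: K_def)
      finally show "norm (\<Sum>m\<in>{1..y}. (\<Sum>k | k dvd m. Lam1 k) * F (d * m)) \<le> U * L * (64 * (U * U) + K)"
        by simp
    qed
    finally show ?thesis unfolding y_def .
  qed

  \<comment> \<open>\<open>al\<close> is cut to 0 up to U, where the type I estimate applies;
    \<open>be\<close> is cut to 0 beyond x, so that its bound by L holds at every positive
    m.\<close>
  define al be :: "nat \<Rightarrow> complex"
    where "al = (\<lambda>d. if d \<le> U then 0 else of_real (moebius_mu d * chi d))"
      and "be = (\<lambda>m. if m \<le> x then of_real (B m * chi m) else 0)"
  define g where "g = (\<lambda>d m :: nat. al d * be m * cis (2 * pi * (theta * sqrt (real (d * m)))))"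
  have al_norm: "norm (al d) \<le> 1" for d
    using mult_mono[OF abs_moebius_mu_le chi, of d d] by (simp add: al_def norm_mult abs_mult)
  have be_norm: "norm (be m) \<le> L" if "m \<ge> 1" for m
  proof (cases "m \<le> x")
    case True
    have "\<bar>B m\<bar> * \<bar>chi m\<bar> \<le> L * 1"
      using B_nonneg[of m] B_le[of m] ln_le[of m] that True L0 chi by (intro mult_mono) auto
    thus ?thesis using True by (simp add: be_def norm_mult)
  qed (use L0 in \<open>auto simp: be_def\<close>)
  \<comment> \<open>The successor makes the upper limit exclusive and costs the factor 2 in
    \<open>d * u d \<le> 2 * x\<close>. For d > x the value must be 0: the outer range extends
    beyond x, and \<open>Suc 0\<close> would violate this inequality for large d.\<close>
  define u where "u = (\<lambda>d. if d \<le> x then Suc (x div d) else 0)"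
  have u: "real d * real (u d) \<le> 2 * x" for d
  proof (cases "d \<le> x")
    case True
    have "d * u d = d + d * (x div d)" "d * (x div d) \<le> x" using True by (simp_all add: u_def)
    hence "d * u d \<le> 2 * x" using True by linarith
    thus ?thesis by (metis of_nat_le_iff of_nat_mult)
  qed (simp add: u_def)
  have mem_u: "m < u d \<longleftrightarrow> d \<le> x \<and> d * m \<le> x" if "d \<ge> 1" for d m
    using that by (auto simp: u_def less_Suc_eq_le less_eq_div_iff_mult_less_eq mult.commute)
  define P where "P = (SIGMA d:{1..x}. {1..x div d})"
  have P: "(d, m) \<in> P \<longleftrightarrow> d \<ge> 1 \<and> m \<ge> 1 \<and> d * m \<le> x" for d m
  proof -
    have "d \<le> x" if "m \<ge> 1" "d * m \<le> x" using that by (metis le_trans mult.right_neutral mult_le_mono2)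
    thus ?thesis by (auto simp: P_def less_eq_div_iff_mult_less_eq mult.commute)
  qed
  have finP: "finite P" by (simp add: P_def)
  have lt_x: "d \<le> x" "m \<le> x" if "(d, m) \<in> P" for d m
    using that unfolding P by (metis le_trans mult.right_neutral mult_le_mono2, metis le_trans mult.left_neutral mult_le_mono1)

  \<comment> \<open>The outer variable is d; the terms with d < U vanish through
    \<open>al\<close>.\<close>
  have part1: "norm (\<Sum>(d, m)\<in>{(d, m)\<in>P. d \<le> m}. g d m) \<le> E"
  proof -
    have "(\<Sum>(d, m)\<in>{(d, m)\<in>P. d \<le> m}. g d m) =
        (\<Sum>(d, m)\<in>(SIGMA d:{U..<U * 2 ^ J}. {d..<u d}). g d m)"
    proof (rule sum.mono_neutral_right)
      show "(SIGMA d:{U..<U * 2 ^ J}. {d..<u d}) \<subseteq> {(d, m)\<in>P. d \<le> m}"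
        using U by (auto simp: P mem_u)
      have "g d m = 0"
        if dm: "(d, m) \<in> P" "d \<le> m" "(d, m) \<notin> (SIGMA d:{U..<U * 2 ^ J}. {d..<u d})" for d m
      proof -
        have "d < U" using dm lt_x[OF dm(1)] x mem_u[of d m] by (auto simp: P)
        thus "g d m = 0" by (simp add: g_def al_def)
      qed
      thus "\<forall>i\<in>{(d, m)\<in>P. d \<le> m} - (SIGMA d:{U..<U * 2 ^ J}. {d..<u d}). (case i of (d, m) \<Rightarrow> g d m) = 0"
        by (auto simp del: mem_Sigma_iff)
      show "finite {(d, m)\<in>P. d \<le> m}" by (rule finite_subset[OF _ finP]) auto
    qed
    also have "\<dots> = (\<Sum>d\<in>{U..<U * 2 ^ J}. \<Sum>m\<in>{d..<u d}. g d m)"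
      by (rule sum.Sigma[symmetric]) auto
    also have "norm \<dots> \<le> J * (1 * L * sqrt ((2 * real x)\<^sup>2 / U + 24 * (2 * real x) * sqrt (2 * real x) * H))"
      unfolding g_def
      by (rule norm_bilinear_sum_dyadic_le) (use U theta al_norm be_norm L0 u H in auto)
    finally show ?thesis by (simp add: E_def)
  qed

  \<comment> \<open>The roles are exchanged: m is the outer variable, and the terms with m < U
    vanish because \<open>B m = 0\<close> there. The lower limit \<open>Suc m\<close> avoids
    counting the diagonal twice.\<close>
  have part2: "norm (\<Sum>(d, m)\<in>{(d, m)\<in>P. m < d}. g d m) \<le> E"
  proof -
    have "(\<Sum>(d, m)\<in>{(d, m)\<in>P. m < d}. g d m) = (\<Sum>(m, d)\<in>{(m, d). (d, m) \<in> P \<and> m < d}. g d m)"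
      by (rule sum.reindex_bij_witness[of _ prod.swap prod.swap]) auto
    also have "\<dots> = (\<Sum>(m, d)\<in>(SIGMA m:{U..<U * 2 ^ J}. {Suc m..<u m}). g d m)"
    proof (rule sum.mono_neutral_right)
      show "(SIGMA m:{U..<U * 2 ^ J}. {Suc m..<u m}) \<subseteq> {(m, d). (d, m) \<in> P \<and> m < d}"
        using U by (auto simp: P mem_u mult.commute)
      have "g d m = 0"
        if dm: "(d, m) \<in> P" "m < d" "(m, d) \<notin> (SIGMA m:{U..<U * 2 ^ J}. {Suc m..<u m})" for d m
      proof -
        have "m < U" "m > 0" using dm lt_x[OF dm(1)] x mem_u[of m d] by (auto simp: P mult.commute)
        thus "g d m = 0" using B_0[of m] by (simp add: g_def be_def)
      qed
      thus "\<forall>i\<in>{(m, d). (d, m) \<in> P \<and> m < d} - (SIGMA m:{U..<U * 2 ^ J}. {Suc m..<u m}).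
              (case i of (m, d) \<Rightarrow> g d m) = 0"
        by (auto simp del: mem_Sigma_iff)
      have "{(m, d). (d, m) \<in> P \<and> m < d} \<subseteq> prod.swap ` P" by auto
      thus "finite {(m, d). (d, m) \<in> P \<and> m < d}" using finP finite_subset by blast
    qed
    also have "\<dots> = (\<Sum>m\<in>{U..<U * 2 ^ J}. \<Sum>d\<in>{Suc m..<u m}. be m * al d * cis (2 * pi * (theta * sqrt (real (m * d)))))"
      by (subst sum.Sigma) (auto simp: g_def mult_ac)
    also have "norm \<dots> \<le> J * (L * 1 * sqrt ((2 * real x)\<^sup>2 / U + 24 * (2 * real x) * sqrt (2 * real x) * H))"
      by (rule norm_bilinear_sum_dyadic_le) (use U theta al_norm be_norm L0 u H in auto)
    finally show ?thesis by (simp add: E_def)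
  qed

  have "(\<Sum>n\<in>{1..x}. of_real (mangoldt n * chi n) * cis (2 * pi * (theta * sqrt (real n)))) =
      (\<Sum>n\<in>{1..x}. of_real (Lam1 n) * F n) + (\<Sum>n\<in>{1..x}. of_real (Lam2 n) * F n)"
    unfolding sum.distrib[symmetric] by (intro sum.cong refl) (simp add: F_def Lam algebra_simps)
  also have "(\<Sum>n\<in>{1..x}. of_real (Lam2 n) * F n) =
      (\<Sum>n\<in>{1..x}. \<Sum>d | d dvd n. of_real (moebius_mu d * B (n div d)) * F (d * (n div d)))"
  proof (intro sum.cong refl)
    fix n assume n: "n \<in> {1..x}"
    have "Lam2 n = (\<Sum>d | d dvd n. moebius_mu d * B (n div d))"
      unfolding B_def by (rule sum_moebius_mu_divisor_sum[symmetric]) (use n in auto)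
    thus "of_real (Lam2 n) * F n = (\<Sum>d | d dvd n. of_real (moebius_mu d * B (n div d)) * F (d * (n div d)))"
      by (simp add: sum_distrib_right)
  qed
  also have "\<dots> = (\<Sum>d\<in>{1..x}. \<Sum>m\<in>{1..x div d}. of_real (moebius_mu d * B m) * F (d * m))"
    by (rule sum_hyperbola)
  also have "\<dots> = (\<Sum>d\<in>{1..x}. (if d \<le> U then moebius_mu d * (\<Sum>m\<in>{1..x div d}. B m * F (d * m)) else 0) +
                                (\<Sum>m\<in>{1..x div d}. g d m))"
  proof (intro sum.cong refl)
    fix d assume d: "d \<in> {1..x}"
    show "(\<Sum>m\<in>{1..x div d}. of_real (moebius_mu d * B m) * F (d * m)) =
        (if d \<le> U then moebius_mu d * (\<Sum>m\<in>{1..x div d}. B m * F (d * m)) else 0) + (\<Sum>m\<in>{1..x div d}. g d m)"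
    proof (cases "d \<le> U")
      case False
      have "m \<le> x" if "m \<in> {1..x div d}" for m
        using that div_le_dividend[of x d] by (auto intro: le_trans)
      thus ?thesis using False by (simp add: g_def al_def be_def F_def mult mult_ac)
    qed (simp add: g_def al_def sum_distrib_left mult_ac)
  qed
  also have "\<dots> = (\<Sum>d\<in>{1..x}. if d \<le> U then moebius_mu d * (\<Sum>m\<in>{1..x div d}. B m * F (d * m)) else 0) +
      (\<Sum>d\<in>{1..x}. \<Sum>m\<in>{1..x div d}. g d m)"
    by (rule sum.distrib)
  also have "(\<Sum>d\<in>{1..x}. \<Sum>m\<in>{1..x div d}. g d m) = (\<Sum>(d, m)\<in>P. g d m)"
    unfolding P_def by (rule sum.Sigma) auto
  also have "\<dots> = (\<Sum>(d, m)\<in>{(d, m)\<in>P. d \<le> m}. g d m) + (\<Sum>(d, m)\<in>{(d, m)\<in>P. m < d}. g d m)"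
    using finP by (subst sum.union_disjoint[symmetric])
      (auto intro!: sum.cong elim: finite_subset[rotated])
  finally have "norm (\<Sum>n\<in>{1..x}. of_real (mangoldt n * chi n) * cis (2 * pi * (theta * sqrt (real n)))) \<le>
      norm (\<Sum>n\<in>{1..x}. of_real (Lam1 n) * F n) +
      (norm (\<Sum>d\<in>{1..x}. if d \<le> U then moebius_mu d * (\<Sum>m\<in>{1..x div d}. B m * F (d * m)) else 0) + (E + E))"
    by (simp only:) (intro norm_triangle_le add_mono order_refl part1 part2)
  also have "norm (\<Sum>n\<in>{1..x}. of_real (Lam1 n) * F n) \<le> U * L"
  proof -
    have "(\<Sum>n\<in>{1..x}. of_real (Lam1 n) * F n) = (\<Sum>n\<in>{1..min x U}. of_real (Lam1 n) * F n)"
      by (intro sum.mono_neutral_right) (auto simp: Lam1_def)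
    also have "norm \<dots> \<le> (\<Sum>n\<in>{1..min x U}. L)"
    proof (rule sum_norm_le)
      fix n assume n: "n \<in> {1..min x U}"
      have "\<bar>Lam1 n\<bar> * norm (F n) \<le> L * 1"
        using man_le[of n] n L0 F_norm by (intro mult_mono) (auto simp: Lam1_def)
      thus "norm (of_real (Lam1 n) * F n) \<le> L" by (simp add: norm_mult)
    qed
    also have "\<dots> \<le> U * L" using L0 by (simp add: mult_right_mono)
    finally show ?thesis .
  qed
  also have "norm (\<Sum>d\<in>{1..x}. if d \<le> U then moebius_mu d * (\<Sum>m\<in>{1..x div d}. B m * F (d * m)) else 0)
      \<le> U * (2 * L * (64 * U + K) + U * L * (64 * (U * U) + K))"
  proof -
    have "(\<Sum>d\<in>{1..x}. if d \<le> U then moebius_mu d * (\<Sum>m\<in>{1..x div d}. B m * F (d * m)) else 0) =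
        (\<Sum>d\<in>{1..min x U}. moebius_mu d * (\<Sum>m\<in>{1..x div d}. B m * F (d * m)))"
      by (intro sum.mono_neutral_cong_right) auto
    also have "norm \<dots> \<le> (\<Sum>d\<in>{1..min x U}. 1 * (2 * L * (64 * U + K) + U * L * (64 * (U * U) + K)))"
    proof (rule sum_norm_le)
      fix d assume "d \<in> {1..min x U}"
      thus "norm (of_real (moebius_mu d) * (\<Sum>m\<in>{1..x div d}. B m * F (d * m)))
          \<le> 1 * (2 * L * (64 * U + K) + U * L * (64 * (U * U) + K))"
        unfolding norm_mult norm_of_real by (intro mult_mono abs_moebius_mu_le small) auto
    qed
    also have "\<dots> = real (min x U) * (2 * L * (64 * U + K) + U * L * (64 * (U * U) + K))" by simp
    also have "\<dots> \<le> U * (2 * L * (64 * U + K) + U * L * (64 * (U * U) + K))"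
      using L0 by (intro mult_right_mono add_nonneg_nonneg mult_nonneg_nonneg) (auto simp: K_def)
    finally show ?thesis .
  qed
  finally show ?thesis by (simp only: E_def K_def mult_2 add.assoc)
qed

text \<open>With U about x^(1/8) the type I part is about U^2 sqrt x = x^(3/4) and the bilinear part
  about x / sqrt U = x^(15/16), up to logarithms. The exponent 31/32 leaves room for these.\<close>

lemma eventually_norm_sum_mangoldt_char_le:
  fixes chi :: "nat \<Rightarrow> real" and theta :: real
  assumes per: "\<And>n. chi (n + 4) = chi n" and chi: "\<And>n. \<bar>chi n\<bar> \<le> 1" and chi0: "chi 0 = 0"
    and mult: "\<And>m n. chi (m * n) = chi m * chi n"
    and theta: "1 / 2 \<le> theta" "theta \<le> 2"
  shows "\<forall>\<^sub>F x in sequentially.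
    norm (\<Sum>n\<in>{1..x}. of_real (mangoldt n * chi n) * cis (2 * pi * (theta * sqrt (real n)))) \<le> real x powr (31 / 32)"
proof -
  \<comment> \<open>\<open>V\<close>, \<open>J\<close> and \<open>H\<close> majorise the rounded
    parameter U, the number of blocks and the harmonic number. In the quotient by U its lower bound
    x^(1/8) is used instead.\<close>
  define V L J H :: "nat \<Rightarrow> real"
    where "V = (\<lambda>x. real x powr (1 / 8) + 1)" and "L = (\<lambda>x. ln (2 * real x))"
      and "J = (\<lambda>x. 2 * ln x + 3)" and "H = (\<lambda>x. 1 + ln (8 * (real x)\<^sup>2))"
  define bound where "bound = (\<lambda>x::nat. V x * L x +
     V x * (2 * L x * (64 * V x + 8 * sqrt (2 * real x)) + V x * L x * (64 * (V x * V x) + 8 * sqrt (2 * real x))) +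
     2 * (J x * (L x * sqrt ((2 * real x)\<^sup>2 / (real x powr (1 / 8)) + 24 * (2 * real x) * sqrt (2 * real x) * H x))))"
  have "\<forall>\<^sub>F x in sequentially. bound x \<le> real x powr (31 / 32)"
    unfolding bound_def V_def L_def J_def H_def by real_asymp
  moreover have "\<forall>\<^sub>F x::nat in sequentially. real x powr (1 / 8) + 1 \<le> 2 * real x"
    by real_asymp
  moreover have "\<forall>\<^sub>F x::nat in sequentially. x \<ge> 1"
    by (rule eventually_ge_at_top)
  ultimately show ?thesis
  proof eventually_elim
    case (elim x)
    define U where "U = nat \<lceil>real x powr (1 / 8)\<rceil>"
    \<comment> \<open>This gives 2 x \<le> 2^j \<le> 4 x: the blocks reach beyond x, while U 2^j
      stays polynomial in x.\<close>
    define j where "j = Suc (nat \<lceil>log 2 x\<rceil>)"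
    have x: "x \<ge> 1" by fact
    have X: "real x powr (1 / 8) > 0" using x by simp
    have U: "real x powr (1 / 8) \<le> U" "U \<le> V x" using X unfolding U_def V_def by linarith+
    have V0: "V x \<ge> 0" using X by (simp add: V_def)
    have "U \<ge> 1" using X U by linarith
    have log0: "log 2 x \<ge> 0" using x by simp
    have j: "log 2 x + 1 \<le> j" "j \<le> log 2 x + 2" unfolding j_def using log0 by linarith+
    have "log 2 x \<le> 2 * ln x"
    proof -
      have "ln x \<le> (2 * ln x) * ln 2"
        using mult_left_mono[of 1 "2 * ln 2" "ln (real x)"] x ln_2_less_1 ln2_ge_two_thirds by simp
      thus ?thesis by (simp add: log_def field_simps)
    qed
    hence jJ: "j \<le> J x" using j by (simp add: J_def)
    have pow: "(2::real) ^ j = 2 powr j" by (simp add: powr_realpow)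
    have "2 * real x = 2 powr (log 2 x + 1)" using x by (simp add: powr_add)
    also have "\<dots> \<le> 2 powr j" using j by (intro powr_mono) auto
    finally have pow_ge: "2 * real x \<le> 2 ^ j" by (simp add: pow)
    have "2 powr j \<le> 2 powr (log 2 x + 2)" using j by (intro powr_mono) auto
    also have "\<dots> = 4 * x" using x by (simp add: powr_add)
    finally have pow_le: "2 ^ j \<le> 4 * real x" by (simp add: pow)
    have "real U * 2 ^ j \<le> (2 * real x) * (4 * real x)"
      using U elim pow_le by (intro mult_mono) (auto simp: V_def)
    hence UJ: "real (U * 2 ^ j) \<le> 8 * (real x)\<^sup>2" by (simp add: power2_eq_square)
    have "harm (U * 2 ^ j) \<le> 1 + ln (real (U * 2 ^ j))"
      using \<open>U \<ge> 1\<close> by (intro harm_le_1_plus_ln) auto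
    also have "\<dots> \<le> H x"
      unfolding H_def using UJ \<open>U \<ge> 1\<close> by (intro add_left_mono ln_mono) auto
    finally have H: "harm (U * 2 ^ j) \<le> H x" .
    have H0: "H x \<ge> 0" using H harm_nonneg[of "U * 2 ^ j", where ?'a = real] by linarith
    have L0: "L x \<ge> 0" using x by (simp add: L_def)
    have "1 * (2 * real x) \<le> real U * 2 ^ j" using pow_ge \<open>U \<ge> 1\<close> x by (intro mult_mono) auto
    hence "real x < real (U * 2 ^ j)" using x by simp
    hence xU: "x < U * 2 ^ j" by (simp only: of_nat_less_iff)
    have "norm (\<Sum>n\<in>{1..x}. of_real (mangoldt n * chi n) * cis (2 * pi * (theta * sqrt (real n))))
     \<le> U * ln (real (2 * x)) + U * (2 * ln (real (2 * x)) * (64 * U + 8 * sqrt (2 * real x)) + U * ln (real (2 * x)) * (64 * (U * U) + 8 * sqrt (2 * real x)))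
        + 2 * (j * (ln (real (2 * x)) * sqrt ((2 * real x)\<^sup>2 / U + 24 * (2 * real x) * sqrt (2 * real x) * H x)))"
      by (rule norm_sum_mangoldt_char_le) (use assms \<open>U \<ge> 1\<close> x xU H in auto)
    also have "\<dots> = U * L x + U * (2 * L x * (64 * real U + 8 * sqrt (2 * real x)) + U * L x * (64 * (real U * real U) + 8 * sqrt (2 * real x)))
        + 2 * (j * (L x * sqrt ((2 * real x)\<^sup>2 / U + 24 * (2 * real x) * sqrt (2 * real x) * H x)))"
      by (simp add: L_def)
    also have "\<dots> \<le> bound x"
      unfolding bound_def
    proof (intro add_mono)
      show "U * L x \<le> V x * L x" using U L0 by (intro mult_right_mono)
      have "2 * L x * (64 * real U + 8 * sqrt (2 * real x)) \<le> 2 * L x * (64 * V x + 8 * sqrt (2 * real x))"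
        using U L0 by (intro mult_left_mono) auto
      moreover have "U * L x \<le> V x * L x" "real U * real U \<le> V x * V x"
        using U L0 by (auto intro!: mult_mono)
      hence "U * L x * (64 * (real U * real U) + 8 * sqrt (2 * real x))
          \<le> V x * L x * (64 * (V x * V x) + 8 * sqrt (2 * real x))"
        using U L0 V0 by (intro mult_mono) auto
      ultimately show "U * (2 * L x * (64 * real U + 8 * sqrt (2 * real x)) + U * L x * (64 * (real U * real U) + 8 * sqrt (2 * real x)))
          \<le> V x * (2 * L x * (64 * V x + 8 * sqrt (2 * real x)) + V x * L x * (64 * (V x * V x) + 8 * sqrt (2 * real x)))"
        using U L0 V0 by (intro mult_mono add_mono) auto
      have "(2 * real x)\<^sup>2 / U \<le> (2 * real x)\<^sup>2 / real x powr (1 / 8)"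
        using U X \<open>U \<ge> 1\<close> by (intro divide_left_mono mult_pos_pos) auto
      hence "sqrt ((2 * real x)\<^sup>2 / U + 24 * (2 * real x) * sqrt (2 * real x) * H x)
          \<le> sqrt ((2 * real x)\<^sup>2 / real x powr (1 / 8) + 24 * (2 * real x) * sqrt (2 * real x) * H x)"
        by simp
      hence *: "L x * sqrt ((2 * real x)\<^sup>2 / U + 24 * (2 * real x) * sqrt (2 * real x) * H x)
          \<le> L x * sqrt ((2 * real x)\<^sup>2 / real x powr (1 / 8) + 24 * (2 * real x) * sqrt (2 * real x) * H x)"
        using L0 by (intro mult_left_mono)
      have "j * (L x * sqrt ((2 * real x)\<^sup>2 / U + 24 * (2 * real x) * sqrt (2 * real x) * H x))
          \<le> J x * (L x * sqrt ((2 * real x)\<^sup>2 / real x powr (1 / 8) + 24 * (2 * real x) * sqrt (2 * real x) * H x))"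
        by (rule mult_mono[OF jJ *]) (use jJ L0 H0 in auto)
      thus "2 * (j * (L x * sqrt ((2 * real x)\<^sup>2 / U + 24 * (2 * real x) * sqrt (2 * real x) * H x)))
          \<le> 2 * (J x * (L x * sqrt ((2 * real x)\<^sup>2 / real x powr (1 / 8) + 24 * (2 * real x) * sqrt (2 * real x) * H x)))"
        by (rule mult_left_mono) simp
    qed
    also have "\<dots> \<le> real x powr (31 / 32)" by fact
    finally show ?case .
  qed
qed

section \<open>Primes congruent to 1 modulo 4\<close>

definition chi4 :: "nat \<Rightarrow> real" where
  "chi4 n = (if n mod 4 = 1 then 1 else if n mod 4 = 3 then -1 else 0)"

lemma chi4_mult: "chi4 (m * n) = chi4 m * chi4 n"
proof -
  have "m mod 4 < 4" "n mod 4 < 4" by simp_all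
  hence "m mod 4 \<in> {0, 1, 2, 3}" "n mod 4 \<in> {0, 1, 2, 3}" by auto
  thus ?thesis
    unfolding chi4_def mod_mult_eq[of m 4 n, symmetric] by auto
qed

lemma sum_ln_ge: "real x * ln x - x \<le> (\<Sum>n\<in>{1..x}. ln (real n))"
proof (induction x)
  case (Suc x)
  show ?case
  proof (cases "x = 0")
    case False
    have "real (Suc x) = real x * (1 + 1 / real x)" using False by (simp add: field_simps)
    hence "ln (real (Suc x)) = ln (real x) + ln (1 + 1 / real x)"
      using False ln_mult_pos[of "real x" "1 + 1 / real x"] by (simp add: add_pos_nonneg)
    moreover have "real x * ln (1 + 1 / real x) \<le> real x * (1 / real x)"
      by (intro mult_left_mono ln_add_one_self_le_self) auto
    ultimately have "real x * ln (real (Suc x)) \<le> real x * ln (real x) + 1"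
      using False by (simp add: algebra_simps)
    thus ?thesis using Suc by (simp add: algebra_simps)
  qed simp
qed simp

text \<open>The lower half of Mertens' first theorem: the logarithm of x! is the sum of floor (x /
  d) \<Lambda>(d), and dropping the floor only increases it.\<close>

lemma sum_mangoldt_over_ge: "x > 0 \<Longrightarrow> ln x - 1 \<le> (\<Sum>n\<in>{1..x}. mangoldt n / real n)"
proof -
  assume x: "x > 0"
  have "real x * ln x - x \<le> (\<Sum>n\<in>{1..x}. ln (real n))" by (rule sum_ln_ge)
  also have "\<dots> = (\<Sum>n\<in>{1..x}. \<Sum>d | d dvd n. mangoldt d)"
    by (intro sum.cong refl) (use mangoldt_sum[where ?'a = real] in auto)
  also have "\<dots> = (\<Sum>d\<in>{1..x}. \<Sum>m\<in>{1..x div d}. mangoldt d)"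
    by (rule sum_hyperbola[of "\<lambda>d _. mangoldt d"])
  also have "\<dots> = (\<Sum>d\<in>{1..x}. real (x div d) * mangoldt d)" by simp
  also have "\<dots> \<le> (\<Sum>d\<in>{1..x}. real x / real d * mangoldt d)"
    by (intro sum_mono mult_right_mono) (auto simp: mangoldt_nonneg of_nat_div_le_of_nat)
  also have "\<dots> = real x * (\<Sum>d\<in>{1..x}. mangoldt d / real d)"
    by (simp add: sum_distrib_left field_simps)
  finally have "real x * (ln x - 1) \<le> real x * (\<Sum>d\<in>{1..x}. mangoldt d / real d)"
    by (simp add: algebra_simps)
  thus ?thesis using x by simp
qed

text \<open>Only the powers of 2 contribute, and their geometric series is at most ln 2.\<close>

lemma sum_even_mangoldt_over_le:
  "(\<Sum>n\<in>{n\<in>{1..x}. even n}. mangoldt n / real n) \<le> 1"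
proof -
  have sub: "{n\<in>{1..x}. even n \<and> primepow n} \<subseteq> (\<lambda>k. 2 ^ k) ` {1..x}"
  proof safe
    fix n :: nat assume n: "n \<in> {1..x}" "even n" "primepow n"
    then obtain p k where pk: "prime p" "k > 0" "n = p ^ k" by (auto simp: primepow_def)
    hence "even p" using n by simp
    hence "p = 2" using pk(1) using primes_dvd_imp_eq[of 2 p] by simp
    moreover have "k \<le> x"
    proof -
      have "k < 2 ^ k" by (rule less_exp)
      also have "2 ^ k \<le> x" using n pk \<open>p = 2\<close> by simp
      finally show ?thesis by simp
    qed
    ultimately show "n \<in> (\<lambda>k. 2 ^ k) ` {1..x}" using pk by auto
  qed
  have "(\<Sum>n\<in>{n\<in>{1..x}. even n}. mangoldt n / real n) =
      (\<Sum>n\<in>{n\<in>{1..x}. even n \<and> primepow n}. mangoldt n / real n)"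
    by (intro sum.mono_neutral_right) (auto simp: mangoldt_def)
  also have "\<dots> \<le> (\<Sum>n\<in>(\<lambda>k. 2 ^ k) ` {1..x}. mangoldt n / real n)"
    by (intro sum_mono2 sub) (auto intro!: divide_nonneg_nonneg mangoldt_nonneg)
  also have "\<dots> = (\<Sum>k\<in>{1..x}. ln 2 * (1 / 2) ^ k)"
    by (subst sum.reindex) (auto simp: inj_on_def power_one_over field_simps intro!: sum.cong)
  also have "\<dots> = ln 2 * (\<Sum>k\<in>{1..x}. (1 / 2) ^ k)" by (simp add: sum_distrib_left)
  also have "(\<Sum>k\<in>{1..x}. (1 / 2 :: real) ^ k) = 1 - (1 / 2) ^ x"
    by (induction x) auto
  also have "ln 2 * (1 - (1 / 2) ^ x) \<le> 1 * (1 :: real)"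
    using ln_2_less_1 by (intro mult_mono) (auto simp: power_le_one)
  finally show ?thesis by simp
qed

text \<open>Summation by parts with 1 / n - 1 / (n + 1) = 1 / (n (n + 1)) leaves the series of n^(s
  - 2), which converges as s < 1. This turns a power saving into bounded partial sums of a(n) /
  n.\<close>

lemma sum_over_index_le:
  fixes a :: "nat \<Rightarrow> real"
  assumes s: "s < 1" and C: "\<And>x. x > 0 \<Longrightarrow> (\<Sum>n\<in>{1..x}. a n) \<le> C * real x powr s"
  shows "\<exists>C'. \<forall>x. (\<Sum>n\<in>{1..x}. a n / real n) \<le> C'"
proof -
  define A where "A = (\<lambda>x. \<Sum>n\<in>{1..x}. a n)"
  define D where "D = max C 0"
  have A: "A x \<le> D * real x powr s" for x
  proof (cases "x = 0")
    case False
    hence "A x \<le> C * real x powr s" unfolding A_def by (intro C) auto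
    also have "\<dots> \<le> D * real x powr s" by (intro mult_right_mono) (auto simp: D_def)
    finally show ?thesis .
  qed (simp add: A_def)
  have D: "D \<ge> 0" by (simp add: D_def)
  have parts: "(\<Sum>n\<in>{1..x}. a n / real n) = A x / (real x + 1) + (\<Sum>n\<in>{1..x}. A n / (real n * (real n + 1)))" for x
  proof (induction x)
    case (Suc x)
    have "A (Suc x) = A x + a (Suc x)" by (simp add: A_def)
    hence "A x / (real x + 1) + a (Suc x) / real (Suc x) = A (Suc x) / (real x + 1)"
      by (simp add: add_divide_distrib add.commute)
    also have "\<dots> = A (Suc x) / (real x + 2) + A (Suc x) / ((real x + 1) * (real x + 2))"
      by (simp add: divide_simps) (simp add: algebra_simps)
    finally show ?case using Suc by (simp add: add_ac)
  qed (simp add: A_def)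
  have summ: "summable (\<lambda>n. D * real n powr (s - 2))"
    using s by (intro summable_mult) (simp add: summable_real_powr_iff)
  have "(\<Sum>n\<in>{1..x}. a n / real n) \<le> D + (\<Sum>n. D * real n powr (s - 2))" for x
  proof -
    have "A x / (real x + 1) \<le> D"
    proof (cases "x = 0")
      case False
      have "A x \<le> D * real x powr s" by (rule A)
      also have "\<dots> \<le> D * real x powr 1" using s False D by (intro mult_left_mono powr_mono) auto
      also have "\<dots> \<le> D * (real x + 1)" using False D by (intro mult_left_mono) auto
      finally show ?thesis by (simp add: field_simps)
    qed (simp add: A_def D)
    moreover have "(\<Sum>n\<in>{1..x}. A n / (real n * (real n + 1))) \<le> (\<Sum>n\<in>{1..x}. D * real n powr (s - 2))"
    proof (rule sum_mono)
      fix n assume n: "n \<in> {1..x}"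
      have "A n / (real n * (real n + 1)) \<le> D * real n powr s / (real n * (real n + 1))"
        using A[of n] n by (intro divide_right_mono) auto
      also have "\<dots> \<le> D * real n powr s / (real n * real n)"
        using D n by (intro divide_left_mono mult_left_mono) auto
      also have "\<dots> = D * real n powr (s - 2)"
        using n by (simp add: powr_diff power2_eq_square)
      finally show "A n / (real n * (real n + 1)) \<le> D * real n powr (s - 2)" .
    qed
    moreover have "(\<Sum>n\<in>{1..x}. D * real n powr (s - 2)) \<le> (\<Sum>n. D * real n powr (s - 2))"
      using D by (intro sum_le_suminf summ) auto
    ultimately show ?thesis unfolding parts by linarith
  qed
  thus ?thesis by blast
qed

lemma interval_4_Suc:
  "{1..4 * Suc k} = {1..4 * k} \<union> {4 * k + 1, 4 * k + 2, 4 * k + 3, 4 * k + 4}"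
  by auto

lemma sum_chi4_Suc:
  fixes f :: "nat \<Rightarrow> real"
  shows "(\<Sum>n\<in>{1..4 * Suc k}. chi4 n * f n) =
    (\<Sum>n\<in>{1..4 * k}. chi4 n * f n) + f (4 * k + 1) - f (4 * k + 3)"
proof -
  have "(4 * k + 2) mod 4 = 2" "(4 * k + 3) mod 4 = 3" "(4 * k + 1) mod 4 = 1" "(4 * k + 4) mod 4 = 0"
    by presburger+
  hence c: "chi4 (4 * k + 1) = 1" "chi4 (4 * k + 2) = 0" "chi4 (4 * k + 3) = -1" "chi4 (4 * k + 4) = 0"
    by (simp_all add: chi4_def)
  show ?thesis
    unfolding interval_4_Suc by (subst sum.union_disjoint) (simp_all add: c[simplified])
qed

text \<open>The alternating series 1 - 1/3 + 1/5 - ...: all its nonempty partial sums lie between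
  the first two, 1 and 2/3.\<close>

lemma sum_chi4_over_bounds:
  assumes "y > 0"
  shows "2 / 3 \<le> (\<Sum>n\<in>{1..y}. chi4 n * (1 / real n))" "(\<Sum>n\<in>{1..y}. chi4 n * (1 / real n)) \<le> 1"
proof -
  define T where "T = (\<lambda>y. \<Sum>n\<in>{1..y}. chi4 n * (1 / real n))"
  have T_Suc: "T (4 * Suc k) = T (4 * k) + 1 / (4 * real k + 1) - 1 / (4 * real k + 3)" for k
    unfolding T_def sum_chi4_Suc by simp
  \<comment> \<open>The next positive term is included so that the induction closes: these sums
    decrease from the value 1 at k = 0.\<close>
  have upper: "T (4 * k) + 1 / (4 * real k + 1) \<le> 1" for k
  proof (induction k)
    case (Suc k)
    have "1 / (4 * real (Suc k) + 1) \<le> 1 / (4 * real k + 3)" by (intro divide_left_mono) auto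
    thus ?case using Suc T_Suc[of k] by linarith
  qed (simp add: T_def)
  have lower: "2 / 3 \<le> T (4 * Suc k)" for k
  proof (induction k)
    case 0
    show ?case using T_Suc[of 0] by (simp add: T_def)
  next
    case (Suc k)
    have "1 / (4 * real (Suc k) + 3) \<le> 1 / (4 * real (Suc k) + 1)" by (intro divide_left_mono) auto
    thus ?case using Suc T_Suc[of "Suc k"] by linarith
  qed
  define k r where "k = y div 4" and "r = y mod 4"
  have y: "y = 4 * k + r" and r: "r \<in> {0, 1, 2, 3}" by (auto simp: k_def r_def)
  have "(4 * k + 2) mod 4 = 2" "(4 * k + 3) mod 4 = 3" "(4 * k + 1) mod 4 = 1" by presburger+
  hence c: "chi4 (4 * k + 1) = 1" "chi4 (4 * k + 2) = 0" "chi4 (4 * k + 3) = -1"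
    by (simp_all add: chi4_def)
  have T_step: "T (y + 1) = T y + chi4 (y + 1) * (1 / real (y + 1))" for y
    by (simp add: T_def)
  have e: "4 * k + 1 + 1 = 4 * k + 2" "4 * k + 2 + 1 = 4 * k + 3" by simp_all
  have T: "T (4 * k + 1) = T (4 * k) + 1 / (4 * real k + 1)"
    "T (4 * k + 2) = T (4 * k) + 1 / (4 * real k + 1)"
    "T (4 * k + 3) = T (4 * k) + 1 / (4 * real k + 1) - 1 / (4 * real k + 3)"
    using T_step[of "4 * k"] T_step[of "4 * k + 1", unfolded e] T_step[of "4 * k + 2", unfolded e] c by auto
  have pos: "1 / (4 * real k + 1) \<ge> 1 / (4 * real k + 3)" "1 / (4 * real k + 3) \<ge> 0"
    by (intro divide_left_mono) auto
  \<comment> \<open>The empty sum at k = 0 violates the lower bound, so the first block carries its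
    explicit values.\<close>
  have low: "2 / 3 \<le> T (4 * k) \<or> k = 0 \<and> T (4 * k) = 0 \<and> 1 / (4 * real k + 1) = 1 \<and> 1 / (4 * real k + 3) = 1 / 3"
    using lower[of "k - 1"] by (cases k) (auto simp: T_def)
  from r consider "r = 0" | "r = 1" | "r = 2" | "r = 3" by auto
  hence "2 / 3 \<le> T y \<and> T y \<le> 1"
  proof cases
    case 1
    hence "T y = T (4 * k)" "k > 0" using y assms by auto
    thus ?thesis using low upper[of k] pos by - (elim disjE conjE; intro conjI; linarith)
  next
    case 2
    hence "T y = T (4 * k) + 1 / (4 * real k + 1)" using y T by simp
    thus ?thesis using low upper[of k] pos by - (elim disjE conjE; intro conjI; linarith)
  next
    case 3
    hence "T y = T (4 * k) + 1 / (4 * real k + 1)" using y T by simp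
    thus ?thesis using low upper[of k] pos by - (elim disjE conjE; intro conjI; linarith)
  next
    case 4
    hence "T y = T (4 * k) + 1 / (4 * real k + 1) - 1 / (4 * real k + 3)" using y T by simp
    thus ?thesis using low upper[of k] pos by - (elim disjE conjE; intro conjI; linarith)
  qed
  thus "2 / 3 \<le> (\<Sum>n\<in>{1..y}. chi4 n * (1 / real n))" "(\<Sum>n\<in>{1..y}. chi4 n * (1 / real n)) \<le> 1"
    by (auto simp: T_def)
qed

text \<open>The first block contributes -(ln 3) / 3. In every later block the argument is past e,
  where ln n / n decreases, so the block is nonnegative.\<close>

lemma sum_chi4_ln_over_ge: "-1 \<le> (\<Sum>n\<in>{1..4 * k}. chi4 n * (ln (real n) / real n))"
proof -
  have *: "- (ln 3 / 3) \<le> (\<Sum>n\<in>{1..4 * Suc k}. chi4 n * (ln (real n) / real n))" for k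
  proof (induction k)
    case 0
    show ?case unfolding sum_chi4_Suc by simp
  next
    case (Suc k)
    define x where "x = real (4 * Suc k + 1)"
    have x: "x \<ge> 3" by (simp add: x_def)
    have "exp 1 \<le> x" using exp_le x by linarith
    hence ln_x: "1 \<le> ln x" using x by (subst ln_ge_iff) auto
    have "x + 2 = x * (1 + 2 / x)" using x by (simp add: field_simps)
    hence "ln (x + 2) = ln x + ln (1 + 2 / x)"
      using x ln_mult_pos[of x "1 + 2 / x"] by (simp add: add_pos_nonneg)
    moreover have "x * ln (1 + 2 / x) \<le> x * (2 / x)"
      using x by (intro mult_left_mono ln_add_one_self_le_self) auto
    ultimately have "x * ln (x + 2) \<le> x * ln x + 2" using x by (simp add: algebra_simps)
    also have "\<dots> \<le> (x + 2) * ln x" using ln_x by (simp add: algebra_simps)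
    finally have "ln (x + 2) / (x + 2) \<le> ln x / x" using x by (simp add: field_simps)
    moreover have "real (4 * Suc k + 3) = x + 2" by (simp add: x_def)
    ultimately have "ln (real (4 * Suc k + 3)) / real (4 * Suc k + 3)
        \<le> ln (real (4 * Suc k + 1)) / real (4 * Suc k + 1)" by (simp only: x_def)
    thus ?case using Suc unfolding sum_chi4_Suc[where k = "Suc k"] by linarith
  qed
  have "ln 3 / 3 \<le> (1::real)" using ln_le_minus_one[of "3::real"] by simp
  hence "-1 \<le> (\<Sum>n\<in>{1..4 * Suc m}. chi4 n * (ln (real n) / real n))" for m
    using *[of m] by linarith
  thus ?thesis by (cases k) (simp, blast)
qed

text \<open>
  The partial sums of \<open>\<chi>\<^sub>4(k) / k\<close> lie in \<open>[2 / 3, 1]\<close>. If the primes congruent to \<open>1\<close> contributed only a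
  bounded amount to \<open>\<Sum> \<Lambda>(n) / n\<close>, then those congruent to \<open>3\<close> would contribute \<open>ln x + O(1)\<close>, so that
  \<open>\<Sum> \<chi>\<^sub>4(n) ln n / n = \<Sum> \<chi>\<^sub>4(m) \<Lambda>(m) / m \<cdot> \<Sum> \<chi>\<^sub>4(k) / k\<close> would be unbounded below.
\<close>

lemma not_power_saving_mangoldt_1_mod_4:
  assumes s: "s < 1"
  shows "\<not> (\<exists>C. \<forall>x>0. (\<Sum>n\<in>{1..x}. if n mod 4 = 1 then mangoldt n else 0) \<le> C * real x powr s)"
proof
  assume "\<exists>C. \<forall>x>0. (\<Sum>n\<in>{1..x}. if n mod 4 = 1 then mangoldt n else 0) \<le> C * real x powr s"
  then obtain C0 where "\<And>x. x > 0 \<Longrightarrow> (\<Sum>n\<in>{1..x}. if n mod 4 = 1 then mangoldt n else 0) \<le> C0 * real x powr s"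
    by blast
  from sum_over_index_le[OF s this] obtain C where
    C: "\<And>x. (\<Sum>n\<in>{1..x}. (if n mod 4 = 1 then mangoldt n else 0) / real n) \<le> C" by blast
  have bound: "-1 \<le> C - 2 / 3 * (ln x - 2 - C)" if x: "x = 4 * Suc k" for x k
  proof -
    define S where "S = (\<lambda>r::nat. \<Sum>n\<in>{1..x}. if n mod 4 = r then mangoldt n / real n else 0)"
    have S1: "S 1 \<le> C"
    proof -
      have "S 1 = (\<Sum>n\<in>{1..x}. (if n mod 4 = 1 then mangoldt n else 0) / real n)"
        unfolding S_def by (intro sum.cong refl) auto
      thus ?thesis using C[of x] by simp
    qed
    have "(\<Sum>n\<in>{1..x}. mangoldt n / real n) =
        (\<Sum>n\<in>{n\<in>{1..x}. even n}. mangoldt n / real n) + (S 1 + S 3)"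
    proof -
      have "(\<Sum>n\<in>{1..x}. mangoldt n / real n) = (\<Sum>n\<in>{1..x}. (if even n then mangoldt n / real n else 0) +
          ((if n mod 4 = 1 then mangoldt n / real n else 0) + (if n mod 4 = 3 then mangoldt n / real n else 0)))"
      proof (rule sum.cong[OF refl])
        fix n :: nat
        have "n mod 4 = 0 \<or> n mod 4 = 1 \<or> n mod 4 = 2 \<or> n mod 4 = 3"
          "even n \<longleftrightarrow> n mod 4 = 0 \<or> n mod 4 = 2" by presburger+
        thus "mangoldt n / real n = (if even n then mangoldt n / real n else 0) +
            ((if n mod 4 = 1 then mangoldt n / real n else 0) + (if n mod 4 = 3 then mangoldt n / real n else 0))"
          by auto
      qed
      thus ?thesis by (simp only: sum.distrib S_def sum.inter_filter finite_atLeastAtMost)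
    qed
    \<comment> \<open>The 2 consists of the error 1 in the Mertens bound and the bound 1 for the
      powers of 2.\<close>
    hence S3: "ln x - 2 - C \<le> S 3"
      using sum_mangoldt_over_ge[of x] sum_even_mangoldt_over_le[of x] S1 x by simp
    have "-1 \<le> (\<Sum>n\<in>{1..x}. chi4 n * (ln (real n) / real n))"
      unfolding x by (rule sum_chi4_ln_over_ge)
    also have "\<dots> = (\<Sum>n\<in>{1..x}. \<Sum>d | d dvd n. (chi4 d * mangoldt d / real d) * (chi4 (n div d) * (1 / real (n div d))))"
    proof (intro sum.cong refl)
      fix n assume n: "n \<in> {1..x}"
      have "chi4 n * (ln (real n) / real n) = (\<Sum>d | d dvd n. chi4 n * (mangoldt d / real n))"
        using mangoldt_sum[of n, where ?'a = real] n by (simp add: sum_distrib_left[symmetric] sum_divide_distrib[symmetric])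
      also have "\<dots> = (\<Sum>d | d dvd n. (chi4 d * mangoldt d / real d) * (chi4 (n div d) * (1 / real (n div d))))"
      proof (intro sum.cong refl)
        fix d assume "d \<in> {d. d dvd n}"
        then obtain e where e: "n = d * e" by (auto elim: dvdE)
        have "d > 0" using e n by (cases d) auto
        thus "chi4 n * (mangoldt d / real n) = (chi4 d * mangoldt d / real d) * (chi4 (n div d) * (1 / real (n div d)))"
          by (simp add: e chi4_mult)
      qed
      finally show "chi4 n * (ln (real n) / real n) =
          (\<Sum>d | d dvd n. (chi4 d * mangoldt d / real d) * (chi4 (n div d) * (1 / real (n div d))))" .
    qed
    also have "\<dots> = (\<Sum>d\<in>{1..x}. \<Sum>m\<in>{1..x div d}. (chi4 d * mangoldt d / real d) * (chi4 m * (1 / real m)))"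
      by (rule sum_hyperbola)
    also have "\<dots> = (\<Sum>d\<in>{1..x}. (chi4 d * mangoldt d / real d) * (\<Sum>m\<in>{1..x div d}. chi4 m * (1 / real m)))"
      by (simp only: sum_distrib_left)
    \<comment> \<open>The sign of \<open>chi4 d\<close> decides which bound on the inner sum is
      used: 1 from above for residue 1, and 2/3 from below for residue 3.\<close>
    also have "\<dots> \<le> (\<Sum>d\<in>{1..x}. (if d mod 4 = 1 then mangoldt d / real d else 0) -
        2 / 3 * (if d mod 4 = 3 then mangoldt d / real d else 0))"
    proof (rule sum_mono)
      fix d assume d: "d \<in> {1..x}"
      hence "x div d > 0" by (simp add: div_greater_zero_iff)
      note T = sum_chi4_over_bounds[OF this]
      have q: "mangoldt d / real d \<ge> 0" by (simp add: mangoldt_nonneg)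
      show "(chi4 d * mangoldt d / real d) * (\<Sum>m\<in>{1..x div d}. chi4 m * (1 / real m)) \<le>
        (if d mod 4 = 1 then mangoldt d / real d else 0) - 2 / 3 * (if d mod 4 = 3 then mangoldt d / real d else 0)"
        using mult_left_mono[OF T(1) q] mult_left_mono[OF T(2) q]
        by (auto simp: chi4_def simp del: One_nat_def)
    qed
    also have "\<dots> = S 1 - 2 / 3 * S 3"
      unfolding sum_subtractf sum_distrib_left[symmetric] S_def ..
    finally have "-1 \<le> S 1 - 2 / 3 * S 3" .
    also have "\<dots> \<le> C - 2 / 3 * (ln x - 2 - C)"
      using S1 S3 by (intro diff_mono mult_left_mono) auto
    finally show ?thesis .
  qed
  \<comment> \<open>Chosen so that 2/3 (ln x - 2 - C) is at least C + 2, which would give -1 \<le>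
    -2.\<close>
  define k where "k = nat \<lceil>exp (2 + C + 3 / 2 * (C + 2))\<rceil>"
  have "2 + C + 3 / 2 * (C + 2) \<le> ln (real (4 * Suc k))"
  proof (subst ln_ge_iff)
    have "exp (2 + C + 3 / 2 * (C + 2)) \<le> real k" unfolding k_def by linarith
    thus "exp (2 + C + 3 / 2 * (C + 2)) \<le> real (4 * Suc k)" by simp
  qed simp
  hence "2 / 3 * (2 + C + 3 / 2 * (C + 2) - 2 - C) \<le> 2 / 3 * (ln (real (4 * Suc k)) - 2 - C)"
    by (intro mult_left_mono diff_right_mono) auto
  moreover have "2 / 3 * (2 + C + 3 / 2 * (C + 2) - 2 - C) = C + 2" by simp
  ultimately show False using bound[OF refl, of k] by linarith
qed

section \<open>Fractional parts of square roots of primes\<close>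

text \<open>A proper prime power p^k up to x has p at most sqrt x and k at most log 2 x, and weighs
  at most ln x.\<close>

lemma sum_mangoldt_nonprime_le:
  assumes x: "x \<ge> 1"
  shows "(\<Sum>n\<in>{1..x}. if prime n then 0 else mangoldt n) \<le> sqrt x * log 2 x * ln x"
proof -
  define P where "P = {1..nat \<lfloor>sqrt x\<rfloor>} \<times> {1..nat \<lfloor>log 2 x\<rfloor>}"
  have log0: "log 2 x \<ge> 0" using x by simp
  have sub: "{n\<in>{1..x}. primepow n \<and> \<not> prime n} \<subseteq> (\<lambda>(p, k). p ^ k) ` P"
  proof safe
    fix n assume n: "n \<in> {1..x}" "primepow n" "\<not> prime n"
    then obtain p k where pk: "prime p" "k > 0" "n = p ^ k" by (auto simp: primepow_def)
    have "k \<noteq> 1" using n pk by auto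
    hence k: "k \<ge> 2" using pk by simp
    have p: "p \<ge> 2" using pk prime_ge_2_nat by simp
    have "p ^ 2 \<le> p ^ k" using k p by (intro power_increasing) auto
    hence "p ^ 2 \<le> x" using n pk by auto
    hence "real (p ^ 2) \<le> real x" by (simp only: of_nat_le_iff)
    hence "real p \<le> sqrt x" by (intro real_le_rsqrt) simp
    hence p_le: "p \<le> nat \<lfloor>sqrt x\<rfloor>" by (rule le_nat_floor)
    have "2 ^ k \<le> p ^ k" using p by (rule power_mono) simp
    also have "p ^ k \<le> x" using n pk by auto
    finally have "2 ^ k \<le> x" .
    hence "real (2 ^ k) \<le> real x" by (simp only: of_nat_le_iff)
    hence "real k \<le> log 2 x" using x by (simp add: le_log_iff powr_realpow)
    hence "k \<le> nat \<lfloor>log 2 x\<rfloor>" by (rule le_nat_floor)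
    hence "(p, k) \<in> P" using p_le p k by (simp add: P_def)
    thus "n \<in> (\<lambda>(p, k). p ^ k) ` P" using pk by force
  qed
  have "(\<Sum>n\<in>{1..x}. if prime n then 0 else mangoldt n) =
      (\<Sum>n\<in>{n\<in>{1..x}. primepow n \<and> \<not> prime n}. mangoldt n :: real)"
    by (intro sum.mono_neutral_cong_right) (auto simp: mangoldt_def)
  also have "\<dots> \<le> (\<Sum>n\<in>{n\<in>{1..x}. primepow n \<and> \<not> prime n}. ln x)"
  proof (rule sum_mono)
    fix n assume "n \<in> {n\<in>{1..x}. primepow n \<and> \<not> prime n}"
    hence n: "n > 0" "n \<le> x" by auto
    have "mangoldt n \<le> ln (real n)" using n by (intro mangoldt_le) auto
    also have "\<dots> \<le> ln x" using n by simp
    finally show "mangoldt n \<le> ln (real x)" .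
  qed
  also have "\<dots> = real (card {n\<in>{1..x}. primepow n \<and> \<not> prime n}) * ln x" by simp
  also have "\<dots> \<le> (sqrt x * log 2 x) * ln x"
  proof (intro mult_right_mono)
    have "card {n\<in>{1..x}. primepow n \<and> \<not> prime n} \<le> card ((\<lambda>(p, k). p ^ k) ` P)"
      by (intro card_mono sub) (simp add: P_def)
    also have "\<dots> \<le> card P" by (rule card_image_le) (simp add: P_def)
    also have "card P = nat \<lfloor>sqrt x\<rfloor> * nat \<lfloor>log 2 x\<rfloor>" by (simp add: P_def card_cartesian_product)
    finally have "real (card {n\<in>{1..x}. primepow n \<and> \<not> prime n}) \<le> real (nat \<lfloor>sqrt x\<rfloor>) * real (nat \<lfloor>log 2 x\<rfloor>)"
      by (simp only: of_nat_le_iff flip: of_nat_mult)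
    also have "\<dots> \<le> sqrt x * log 2 x" using log0 by (intro mult_mono) auto
    finally show "real (card {n\<in>{1..x}. primepow n \<and> \<not> prime n}) \<le> sqrt x * log 2 x" .
  qed (use x in auto)
  finally show ?thesis .
qed

definition mangoldt_1_4 :: "nat \<Rightarrow> real" where
  "mangoldt_1_4 n = (if n mod 4 = 1 then mangoldt n else 0)"

lemma eventually_sum_mangoldt_1_4_cos_le:
  assumes h: "1 \<le> h" "h \<le> 4"
  shows "\<forall>\<^sub>F x in sequentially.
    \<bar>\<Sum>n\<in>{1..x}. mangoldt_1_4 n * cos (h * (pi * sqrt (real n) - pi / 4))\<bar> \<le> real x powr (31 / 32)"
proof -
  define E where "E = (\<lambda>chi x. \<Sum>n\<in>{1..x::nat}. complex_of_real (mangoldt n * chi n) * cis (2 * pi * (h / 2 * sqrt (real n))))"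
  have per: "chi4 (n + 4) = chi4 n" for n by (simp add: chi4_def)
  have abs: "\<bar>chi4 n\<bar> \<le> 1" "\<bar>(chi4 n)\<^sup>2\<bar> \<le> 1" for n by (simp_all add: chi4_def)
  have zero: "chi4 0 = 0" by (simp add: chi4_def)
  have "\<forall>\<^sub>F x in sequentially. norm (E chi4 x) \<le> real x powr (31 / 32)"
    unfolding E_def by (rule eventually_norm_sum_mangoldt_char_le) (use h per abs zero chi4_mult in auto)
  moreover have "\<forall>\<^sub>F x in sequentially. norm (E (\<lambda>n. (chi4 n)\<^sup>2) x) \<le> real x powr (31 / 32)"
    unfolding E_def
    by (rule eventually_norm_sum_mangoldt_char_le) (use h per abs zero chi4_mult in \<open>auto simp: power_mult_distrib\<close>)
  ultimately show ?thesis
  proof eventually_elim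
    case (elim x)
    have term_eq: "complex_of_real (mangoldt_1_4 n) * cis (h * (pi * sqrt (real n) - pi / 4)) =
        cis (- (h * pi / 4)) / 2 * (of_real (mangoldt n * chi4 n) * cis (2 * pi * (h / 2 * sqrt (real n))) +
          of_real (mangoldt n * (chi4 n)\<^sup>2) * cis (2 * pi * (h / 2 * sqrt (real n))))" for n
    proof -
      have "cis (h * (pi * sqrt (real n) - pi / 4)) = cis (- (h * pi / 4)) * cis (2 * pi * (h / 2 * sqrt (real n)))"
        by (simp add: cis_mult algebra_simps)
      moreover have "complex_of_real (mangoldt_1_4 n) =
          (of_real (mangoldt n * chi4 n) + of_real (mangoldt n * (chi4 n)\<^sup>2)) / 2"
        by (simp add: mangoldt_1_4_def chi4_def)
      ultimately show ?thesis by (simp only: distrib_right add_divide_distrib) (simp add: ring_distribs mult_ac)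
    qed
    have "(\<Sum>n\<in>{1..x}. mangoldt_1_4 n * cos (h * (pi * sqrt (real n) - pi / 4))) =
        Re (\<Sum>n\<in>{1..x}. complex_of_real (mangoldt_1_4 n) * cis (h * (pi * sqrt (real n) - pi / 4)))"
      by (simp add: Re_sum)
    also have "\<bar>\<dots>\<bar> \<le> norm (\<Sum>n\<in>{1..x}. complex_of_real (mangoldt_1_4 n) * cis (h * (pi * sqrt (real n) - pi / 4)))"
      by (rule abs_Re_le_cmod)
    also have "(\<Sum>n\<in>{1..x}. complex_of_real (mangoldt_1_4 n) * cis (h * (pi * sqrt (real n) - pi / 4))) =
        cis (- (h * pi / 4)) / 2 * (E chi4 x + E (\<lambda>n. (chi4 n)\<^sup>2) x)"
      unfolding term_eq E_def sum.distrib[symmetric] sum_distrib_left ..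
    also have "norm \<dots> \<le> 1 / 2 * (real x powr (31 / 32) + real x powr (31 / 32))"
      using norm_triangle_le[OF add_mono[OF elim]] by (simp add: norm_mult norm_divide)
    finally show ?case by simp
  qed
qed

text \<open>
  The polynomial vanishes to third order at \<open>cos u = -1\<close>, which concentrates its mass near \<open>u = 0\<close>
  enough to make the constant Fourier coefficient positive for any cut-off below \<open>3 / 4\<close>.
\<close>

lemma cos_cutoff_polynomial:
  "(cos u - c) * (1 + cos u) ^ 3 = (15 - 20 * c) / 8 + (13 - 15 * c) / 4 * cos (1 * u) +
     (4 - 3 * c) / 2 * cos (2 * u) + (3 - c) / 4 * cos (3 * u) + 1 / 8 * cos (4 * (u :: real))"
proof -
  define C S where "C = cos u" and "S = sin u"
  have S: "S * S = 1 - C * C" by (simp add: C_def S_def sin_squared_eq flip: power2_eq_square)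
  have c2: "cos (2 * u) = 2 * (C * C) - 1"
    by (simp add: C_def cos_double_cos power2_eq_square)
  have s2: "sin (2 * u) = 2 * S * C" by (simp add: C_def S_def sin_double)
  have "cos (3 * u) = cos (2 * u + u)" by simp
  also have "\<dots> = (2 * (C * C) - 1) * C - 2 * S * C * S"
    unfolding cos_add c2 s2 by (simp add: C_def S_def)
  also have "\<dots> = (2 * (C * C) - 1) * C - 2 * C * (1 - C * C)" using S by (simp add: mult_ac)
  finally have c3: "cos (3 * u) = 4 * C ^ 3 - 3 * C" by (simp add: algebra_simps power3_eq_cube)
  have "cos (4 * u) = cos (2 * (2 * u))" by simp
  also have "\<dots> = 2 * (cos (2 * u))\<^sup>2 - 1" by (rule cos_double_cos)
  finally have c4: "cos (4 * u) = 8 * C ^ 4 - 8 * C\<^sup>2 + 1"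
    unfolding c2 by (simp add: algebra_simps power2_eq_square power4_eq_xxxx)
  show ?thesis
    unfolding c2 c3 c4 by (simp add: C_def[symmetric] field_simps power2_eq_square power3_eq_cube power4_eq_xxxx)
qed

lemma cos_gt_imp_near_2pi_multiple:
  assumes x0: "0 \<le> x0" "x0 \<le> pi" and u: "cos x0 < cos u"
  obtains m :: int where "\<bar>u - 2 * pi * m\<bar> < x0"
proof -
  define m where "m = round (u / (2 * pi))"
  define v where "v = u - 2 * pi * m"
  have "\<bar>of_int m - u / (2 * pi)\<bar> \<le> 1 / 2" unfolding m_def by (rule of_int_round_abs_le)
  hence "2 * pi * \<bar>of_int m - u / (2 * pi)\<bar> \<le> 2 * pi * (1 / 2)" by (intro mult_left_mono) auto
  moreover have "2 * pi * \<bar>of_int m - u / (2 * pi)\<bar> = \<bar>2 * pi * (of_int m - u / (2 * pi))\<bar>"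
    by (simp add: abs_mult)
  ultimately have v: "\<bar>v\<bar> \<le> pi" by (simp add: v_def right_diff_distrib abs_minus_commute)
  have "cos \<bar>v\<bar> = cos v" by (simp add: abs_if)
  also have "\<dots> = cos u"
    using cos_int_2pin[of m] sin_int_2pin[of m] by (simp add: v_def cos_diff mult_ac)
  finally have "cos x0 < cos \<bar>v\<bar>" using u by simp
  moreover have "cos x0 < cos \<bar>v\<bar> \<longleftrightarrow> \<bar>v\<bar> < x0"
    by (rule cos_mono_less_eq) (use x0 v in auto)
  ultimately have "\<bar>v\<bar> < x0" by blast
  thus ?thesis using that[of m] by (simp add: v_def)
qed

text \<open>If only finitely many primes met the window, the sum of \<Lambda> \<open>T\<close> over
  the class 1 modulo 4 would have a negligible upper bound, as positive contributions would come
  only from those primes and from proper prime powers. Since \<open>T\<close> has positive mean and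
  its other frequencies have a power saving, \<open>psi\<close> would have one too.\<close>

lemma infinite_primes_1_mod_4_sqrt_window:
  obtains eta :: real where "eta > 0"
    "infinite {p::nat. prime p \<and> p mod 4 = 1 \<and> (\<exists>n::nat. 2 * real n + eta \<le> sqrt p \<and> sqrt p \<le> 2 * real n + 1 / 2 - eta)}"
proof -
  \<comment> \<open>A rational strictly between sqrt 2 / 2 and 3/4: the first keeps the positive
    part of \<open>T\<close> inside the window with a margin \<open>eta\<close>, the second makes
    the mean (15 - 20 c) / 8 = 1/40 positive.\<close>
  define c :: real where "c = 37 / 50"
  define x0 where "x0 = arccos c"
  define eta where "eta = 1 / 4 - x0 / pi"
  \<comment> \<open>The period 2 pi in u is the period 2 in sqrt n, and u = 0 is the centre 1/4 of
    the window.\<close>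
  define u where "u = (\<lambda>n::nat. pi * sqrt (real n) - pi / 4)"
  define T where "T = (\<lambda>n. (cos (u n) - c) * (1 + cos (u n)) ^ 3)"
  define G where "G = {p::nat. prime p \<and> p mod 4 = 1 \<and> (\<exists>n::nat. 2 * real n + eta \<le> sqrt p \<and> sqrt p \<le> 2 * real n + 1 / 2 - eta)}"
  have x0: "0 \<le> x0" "x0 \<le> pi" "cos x0 = c" by (auto simp: x0_def c_def intro!: arccos_lbound arccos_ubound)
  have "sqrt 2 < 37 / 25" by (rule real_less_lsqrt) (auto simp: power2_eq_square)
  hence "sqrt 2 / 2 < c" by (simp add: c_def)
  hence "cos (pi / 4) < cos x0" by (simp add: x0 cos_45)
  hence "x0 < pi / 4" using x0 cos_mono_less_eq[of "pi / 4" x0] by simp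
  hence eta: "eta > 0" by (simp add: eta_def field_simps)
  have T_le: "T n \<le> 8" for n
  proof -
    have "(cos (u n) - c) * (1 + cos (u n)) ^ 3 \<le> 1 * 2 ^ 3"
    proof (cases "cos (u n) \<ge> c")
      case True
      have "1 + cos (u n) \<ge> 0" using cos_ge_minus_one[of "u n"] by linarith
      moreover have "cos (u n) \<le> 1" by simp
      moreover from this have "cos (u n) - c \<le> 1" unfolding c_def by linarith
      ultimately show ?thesis using True by (intro mult_mono power_mono) auto
    next
      case False
      have "1 + cos (u n) \<ge> 0" using cos_ge_minus_one[of "u n"] by linarith
      hence "(cos (u n) - c) * (1 + cos (u n)) ^ 3 \<le> 0" using False by (intro mult_nonpos_nonneg) auto
      thus ?thesis by simp
    qed
    thus ?thesis by (simp add: T_def)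
  qed
  have T_nonpos: "T n \<le> 0" if n: "n > 0" "prime n" "n mod 4 = 1" "n \<notin> G" for n
  proof (rule ccontr)
    assume "\<not> T n \<le> 0"
    moreover have "1 + cos (u n) \<ge> 0" using cos_ge_minus_one[of "u n"] by linarith
    hence "(1 + cos (u n)) ^ 3 \<ge> 0" by (rule zero_le_power)
    ultimately have "cos x0 < cos (u n)" unfolding x0 T_def by (auto simp: not_le zero_less_mult_iff)
    then obtain m :: int where m: "\<bar>u n - 2 * pi * m\<bar> < x0"
      using cos_gt_imp_near_2pi_multiple x0 by metis
    have "u n - 2 * pi * m = pi * (sqrt n - 1 / 4 - 2 * m)" by (simp add: u_def algebra_simps)
    hence "pi * \<bar>sqrt n - 1 / 4 - 2 * m\<bar> < x0" using m by (simp add: abs_mult)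
    hence "\<bar>sqrt n - 1 / 4 - 2 * m\<bar> < x0 / pi" by (simp add: field_simps)
    hence b: "\<bar>sqrt n - 1 / 4 - 2 * m\<bar> < 1 / 4 - eta" by (simp add: eta_def)
    \<comment> \<open>The nearest multiple of 2 is so far only an integer; this bound makes it
      positive, hence a natural number.\<close>
    have "sqrt n \<ge> 1" using n by simp
    hence "real_of_int m > 0" using b eta by linarith
    hence "real_of_int m = real (nat m)" by simp
    hence "2 * real (nat m) + eta \<le> sqrt n \<and> sqrt n \<le> 2 * real (nat m) + 1 / 2 - eta"
      using b by linarith
    hence "n \<in> G" using n unfolding G_def by blast
    thus False using n by simp
  qed
  have "infinite G"
  proof
    assume fin: "finite G"
    define psi where "psi = (\<lambda>x. \<Sum>n\<in>{1..x}. mangoldt_1_4 n)"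
    define s :: real where "s = 31 / 32"
    define S where "S = (\<lambda>h x. \<Sum>n\<in>{1..x}. mangoldt_1_4 n * cos (h * u n))"
    define K where "K = 8 * (\<Sum>p\<in>G. mangoldt p :: real)"
    have w0: "0 \<le> mangoldt_1_4 n" "mangoldt_1_4 n \<le> mangoldt n" for n
      by (simp_all add: mangoldt_1_4_def mangoldt_nonneg)
    have upper: "(\<Sum>n\<in>{1..x}. mangoldt_1_4 n * T n) \<le> K + 8 * (sqrt x * log 2 x * ln x)" if "x \<ge> 1" for x
    proof -
      have "(\<Sum>n\<in>{1..x}. mangoldt_1_4 n * T n) \<le>
          (\<Sum>n\<in>{1..x}. 8 * (if n \<in> G then mangoldt n else 0) + 8 * (if prime n then 0 else mangoldt n))"
      proof (rule sum_mono)
        fix n assume n: "n \<in> {1..x}"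
        show "mangoldt_1_4 n * T n \<le> 8 * (if n \<in> G then mangoldt n else 0) + 8 * (if prime n then 0 else mangoldt n)"
        proof (cases "prime n \<and> n \<notin> G")
          case True
          hence "mangoldt_1_4 n * T n \<le> 0"
            using T_nonpos[of n] w0[of n] n by (cases "n mod 4 = 1") (auto simp: mult_nonneg_nonpos mangoldt_1_4_def)
          thus ?thesis using True by simp
        next
          case False
          have "mangoldt_1_4 n * T n \<le> mangoldt_1_4 n * 8" using T_le w0 by (intro mult_left_mono)
          also have "\<dots> \<le> mangoldt n * 8" using w0 by (intro mult_right_mono) auto
          finally show ?thesis using False mangoldt_nonneg[of n] by auto
        qed
      qed
      also have "\<dots> = 8 * (\<Sum>n\<in>{1..x}. if n \<in> G then mangoldt n else 0) + 8 * (\<Sum>n\<in>{1..x}. if prime n then 0 else mangoldt n)"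
        by (simp only: sum.distrib sum_distrib_left)
      also have "(\<Sum>n\<in>{1..x}. if n \<in> G then mangoldt n else 0) = (\<Sum>n\<in>{1..x} \<inter> G. mangoldt n :: real)"
        by (simp add: sum.inter_restrict)
      also have "\<dots> \<le> (\<Sum>n\<in>G. mangoldt n :: real)"
        using fin by (intro sum_mono2) (auto simp: mangoldt_nonneg)
      finally show ?thesis using sum_mangoldt_nonprime_le[OF that] unfolding K_def by linarith
    qed
    have expand: "(\<Sum>n\<in>{1..x}. mangoldt_1_4 n * T n) = (15 - 20 * c) / 8 * psi x + (13 - 15 * c) / 4 * S 1 x +
        (4 - 3 * c) / 2 * S 2 x + (3 - c) / 4 * S 3 x + 1 / 8 * S 4 x" for x
      unfolding T_def cos_cutoff_polynomial psi_def S_def sum_distrib_left sum.distrib[symmetric]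
      by (intro sum.cong refl) (simp only: algebra_simps)
    have S: "\<forall>\<^sub>F x in sequentially. \<bar>S h x\<bar> \<le> real x powr s" if "1 \<le> h" "h \<le> 4" for h
      unfolding S_def u_def s_def by (rule eventually_sum_mangoldt_1_4_cos_le[OF that])
    have small: "\<forall>\<^sub>F x::nat in sequentially. K + 8 * (sqrt x * log 2 x * ln x) \<le> real x powr s"
      unfolding s_def by real_asymp
    have "\<forall>\<^sub>F x::nat in sequentially. x \<ge> 1" by (rule eventually_ge_at_top)
    with S[of 1, simplified] S[of 2, simplified] S[of 3, simplified] S[of 4, simplified] small
    have "\<forall>\<^sub>F x in sequentially. psi x \<le> 400 * real x powr s"
    proof eventually_elim
      case (elim x)
      \<comment> \<open>The Fourier coefficients at c = 37/50. Together with the upper bound for the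
        first sum they add up to less than 10.\<close>
      have "1 / 40 * psi x = (\<Sum>n\<in>{1..x}. mangoldt_1_4 n * T n) - 19 / 40 * S 1 x - 89 / 100 * S 2 x - 113 / 200 * S 3 x - 1 / 8 * S 4 x"
        unfolding expand by (simp add: c_def field_simps)
      also have "\<dots> \<le> 10 * real x powr s"
        using upper[OF elim(6)] elim(1-5) by (simp add: abs_le_iff)
      finally show ?case by simp
    qed
    then obtain N where N: "\<And>x. x \<ge> N \<Longrightarrow> psi x \<le> 400 * real x powr s"
      by (auto simp: eventually_sequentially)
    have psi_mono: "psi x \<le> psi y" if "x \<le> y" for x y
      unfolding psi_def using that w0 by (intro sum_mono2) auto
    have psi0: "psi x \<ge> 0" for x unfolding psi_def using w0 by (intro sum_nonneg) auto
    have "psi x \<le> (400 + psi N) * real x powr s" if x: "x > 0" for x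
    proof (cases "x \<ge> N")
      case True
      thus ?thesis using N[OF True] psi0[of N] by (simp add: distrib_right add_increasing2)
    next
      case False
      have "1 \<le> real x powr s" using x by (simp add: s_def ge_one_powr_ge_zero)
      hence "psi N * 1 \<le> psi N * real x powr s" using psi0 by (intro mult_left_mono)
      moreover have "psi x \<le> psi N" using False by (intro psi_mono) auto
      ultimately show ?thesis by (simp add: distrib_right add_increasing)
    qed
    moreover have "\<not> (\<exists>C. \<forall>x>0. psi x \<le> C * real x powr s)"
      using not_power_saving_mangoldt_1_mod_4[of s] unfolding psi_def mangoldt_1_4_def s_def by simp
    ultimately show False by blast
  qed
  thus ?thesis using that[OF eta] unfolding G_def by blast
qed

section \<open>Parameters of the Paley graph\<close>

lemma sum_mod_affine:
  fixes p a b :: int and f :: "int \<Rightarrow> 'a :: comm_monoid_add"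
  assumes p: "p > 0" and a: "coprime a p"
  shows "(\<Sum>z\<in>{0..<p}. f ((a * z + b) mod p)) = (\<Sum>z\<in>{0..<p}. f z)"
proof -
  define g where "g = (\<lambda>z. (a * z + b) mod p)"
  have inj: "inj_on g {0..<p}"
  proof (rule inj_onI)
    fix y z assume yz: "y \<in> {0..<p}" "z \<in> {0..<p}" "g y = g z"
    hence "[a * y = a * z] (mod p)" by (simp add: g_def Cong.cong_def[symmetric] cong_add_rcancel)
    hence "[y = z] (mod p)" using a by (simp add: cong_mult_lcancel)
    thus "y = z" using yz by (simp add: Cong.cong_def)
  qed
  have "g ` {0..<p} = {0..<p}"
    using p by (intro endo_inj_surj inj) (auto simp: g_def)
  hence "(\<Sum>z\<in>{0..<p}. f z) = (\<Sum>z\<in>{0..<p}. f (g z))"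
    using sum.reindex[OF inj, of f] by simp
  thus ?thesis by (simp add: g_def)
qed

lemma Legendre_mod [simp]: "Legendre (a mod p) p = Legendre a p"
  by (simp add: Legendre_def QuadRes_def Cong.cong_def)

lemma Legendre_values: "Legendre a p \<in> {-1, 0, 1}"
  by (simp add: Legendre_def)

lemma Legendre_eq_if_cong:
  assumes "p > 2" "[x = y] (mod p)" "x \<in> {-1, 0, 1}" "y \<in> {-1, 0, 1}"
  shows "x = (y :: int)"
proof -
  have "p dvd x - y" using assms(2) by (simp add: cong_iff_dvd_diff)
  moreover have "\<bar>x - y\<bar> < p" using assms by auto
  ultimately show ?thesis using dvd_imp_le_int[of "x - y" p] by (cases "x = y") auto
qed

text \<open>Euler's criterion makes both sides congruent modulo p, and values in {-1, 0, 1} that are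
  congruent modulo p > 2 are equal.\<close>

lemma Legendre_mult:
  assumes p: "prime p" "p > 2"
  shows "Legendre (a * b) p = Legendre a p * Legendre b p"
proof (rule Legendre_eq_if_cong)
  have e: "[Legendre c (int (nat p)) = c ^ ((nat p - 1) div 2)] (mod int (nat p))" for c
    using p by (intro euler_criterion) (auto simp: prime_nat_iff_prime)
  have p': "int (nat p) = p" using p by simp
  have "[Legendre (a * b) p = a ^ ((nat p - 1) div 2) * b ^ ((nat p - 1) div 2)] (mod p)"
    using e[of "a * b"] unfolding p' by (simp add: power_mult_distrib)
  moreover have "[Legendre a p * Legendre b p = a ^ ((nat p - 1) div 2) * b ^ ((nat p - 1) div 2)] (mod p)"
    using e[of a] e[of b] unfolding p' by (rule cong_mult)
  ultimately show "[Legendre (a * b) p = Legendre a p * Legendre b p] (mod p)"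
    by (metis cong_sym cong_trans)
  show "Legendre a p * Legendre b p \<in> {-1, 0, 1}"
    using Legendre_values[of a p] Legendre_values[of b p] by auto
qed (use p Legendre_values in auto)

context
  fixes p :: int
  assumes p: "prime p" "p > 2"
begin

private lemma p_pos: "p > 0" using p by simp

lemma Legendre_eq_0_iff: "Legendre a p = 0 \<longleftrightarrow> p dvd a"
  by (auto simp: Legendre_def cong_0_iff)

text \<open>Otherwise squaring would be surjective, hence injective, on the residues; but 1 and p -
  1 have the same square.\<close>

lemma ex_nonresidue: "\<exists>g. Legendre g p = -1"
proof (rule ccontr)
  assume no: "\<nexists>g. Legendre g p = -1"
  define sq where "sq = (\<lambda>z::int. z\<^sup>2 mod p)"
  have "{0..<p} \<subseteq> sq ` {0..<p}"
  proof
    fix a assume a: "a \<in> {0..<p}"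
    have "\<exists>y. [y\<^sup>2 = a] (mod p)"
    proof (cases "a = 0")
      case True
      thus ?thesis by (intro exI[of _ 0]) simp
    next
      case False
      hence "\<not> [a = 0] (mod p)" using a by (auto simp: Cong.cong_def)
      hence "QuadRes p a" using no by (auto simp: Legendre_def split: if_splits)
      thus ?thesis by (simp add: QuadRes_def)
    qed
    then obtain y where "[y\<^sup>2 = a] (mod p)" by blast
    hence "sq (y mod p) = a" using a by (simp add: sq_def Cong.cong_def power_mod)
    moreover have "y mod p \<in> {0..<p}" using p_pos by simp
    ultimately show "a \<in> sq ` {0..<p}" by blast
  qed
  hence "inj_on sq {0..<p}" by (intro finite_surj_inj) auto
  moreover have "sq 1 = sq (p - 1)"
  proof -
    have "(p - 1)\<^sup>2 = 1 + p * (p - 2)" by (simp add: power2_eq_square algebra_simps)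
    thus ?thesis unfolding sq_def by (simp add: mod_mult_self2)
  qed
  ultimately have "1 = p - 1" using p by (auto dest!: inj_onD)
  thus False using p by simp
qed

text \<open>Multiplication by a nonresidue permutes the residues and negates the sum.\<close>

lemma sum_Legendre: "(\<Sum>z\<in>{0..<p}. Legendre z p) = 0"
proof -
  obtain g where g: "Legendre g p = -1" using ex_nonresidue by blast
  hence "\<not> p dvd g" using Legendre_eq_0_iff[of g] by auto
  hence cop: "coprime g p" using p by (metis prime_imp_coprime coprime_commute)
  have "(\<Sum>z\<in>{0..<p}. Legendre z p) = (\<Sum>z\<in>{0..<p}. Legendre ((g * z + 0) mod p) p)"
    by (rule sum_mod_affine[OF p_pos cop, symmetric])
  also have "\<dots> = (\<Sum>z\<in>{0..<p}. - Legendre z p)"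
    using p g by (simp add: Legendre_mult)
  finally show ?thesis by (simp add: sum_negf)
qed

lemma sum_Legendre_affine:
  assumes "coprime a p"
  shows "(\<Sum>z\<in>{0..<p}. Legendre (a * z + b) p) = 0"
  using sum_mod_affine[OF p_pos assms, of "\<lambda>z. Legendre z p" b] by (simp add: sum_Legendre)

text \<open>
  Scaling by \<open>c\<close> shows that the correlation is the same for all non-zero shifts \<open>c\<close>, and the
  correlations of all shifts add up to \<open>0\<close>.
\<close>

lemma sum_Legendre_shift:
  assumes c: "\<not> p dvd c"
  shows "(\<Sum>z\<in>{0..<p}. Legendre z p * Legendre (z + c) p) = -1"
proof -
  define J where "J = (\<lambda>c. \<Sum>z\<in>{0..<p}. Legendre z p * Legendre (z + c) p)"
  have J_const: "J c = J 1" if c: "\<not> p dvd c" for c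
  proof -
    have cop: "coprime c p" using c p by (metis prime_imp_coprime coprime_commute)
    have sq: "Legendre c p * Legendre c p = 1"
      using Legendre_values[of c p] Legendre_eq_0_iff[of c] c by auto
    have "J c = (\<Sum>z\<in>{0..<p}. Legendre ((c * z + 0) mod p) p * Legendre ((c * z + 0) mod p + c) p)"
      unfolding J_def
      by (rule sum_mod_affine[OF p_pos cop, of "\<lambda>z. Legendre z p * Legendre (z + c) p" 0, symmetric])
    also have "\<dots> = (\<Sum>z\<in>{0..<p}. (Legendre c p * Legendre c p) * (Legendre z p * Legendre (z + 1) p))"
    proof (rule sum.cong[OF refl])
      fix z
      have "Legendre ((c * z + 0) mod p + c) p = Legendre (((c * z + 0) mod p + c) mod p) p" by simp
      also have "((c * z + 0) mod p + c) mod p = (c * (z + 1)) mod p"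
        by (simp add: mod_add_left_eq distrib_left)
      finally have "Legendre ((c * z + 0) mod p + c) p = Legendre c p * Legendre (z + 1) p"
        using p by (simp add: Legendre_mult)
      thus "Legendre ((c * z + 0) mod p) p * Legendre ((c * z + 0) mod p + c) p =
          (Legendre c p * Legendre c p) * (Legendre z p * Legendre (z + 1) p)"
        using p by (simp add: Legendre_mult mult_ac)
    qed
    also have "\<dots> = J 1" by (simp add: sq J_def)
    finally show ?thesis .
  qed
  have "(\<Sum>c\<in>{0..<p}. J c) = (\<Sum>z\<in>{0..<p}. \<Sum>c\<in>{0..<p}. Legendre z p * Legendre (z + c) p)"
    unfolding J_def by (rule sum.swap)
  also have "\<dots> = (\<Sum>z\<in>{0..<p}. Legendre z p * (\<Sum>c\<in>{0..<p}. Legendre (1 * c + z) p))"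
    by (simp add: sum_distrib_left add.commute)
  also have "\<dots> = 0" by (subst sum_Legendre_affine) auto
  finally have "0 = (\<Sum>c\<in>{0..<p}. J c)" ..
  also have "\<dots> = J 0 + (\<Sum>c\<in>{0..<p} - {0}. J c)" using p_pos by (intro sum.remove) auto
  also have "(\<Sum>c\<in>{0..<p} - {0}. J c) = (\<Sum>c\<in>{0..<p} - {0}. J 1)"
    by (intro sum.cong refl J_const) (auto dest: zdvd_imp_le)
  also have "\<dots> = (p - 1) * J 1" using p_pos by (simp add: card_Diff_singleton)
  also have "J 0 = p - 1"
  proof -
    have "J 0 = (\<Sum>z\<in>{0..<p}. if z = 0 then 0 else 1)"
      unfolding J_def
    proof (rule sum.cong[OF refl])
      fix z assume z: "z \<in> {0..<p}"
      have "p dvd z \<longleftrightarrow> z = 0" using z by (auto dest: zdvd_imp_le)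
      thus "Legendre z p * Legendre (z + 0) p = (if z = 0 then 0 else 1)"
        using Legendre_values[of z p] Legendre_eq_0_iff[of z] by auto
    qed
    also have "\<dots> = (\<Sum>z\<in>{0..<p} - {0}. 1)" by (intro sum.mono_neutral_cong_right) auto
    also have "\<dots> = p - 1" using p_pos by (simp add: card_Diff_singleton)
    finally show ?thesis .
  qed
  finally have e: "0 = p - 1 + (p - 1) * J 1" .
  have "(p - 1) * (J 1 + 1) = p - 1 + (p - 1) * J 1" by (simp add: algebra_simps)
  with e have "(p - 1) * (J 1 + 1) = 0" by simp
  hence "J 1 = -1" using p by simp
  thus ?thesis using J_const[OF c] by (simp add: J_def)
qed

end

lemma strongly_regular_paley_graph:
  assumes p: "prime p" "p mod 4 = 1"
  shows "strongly_regular (paley_graph p) p ((p - 1) div 2) ((p - 5) div 4) ((p - 1) div 4)"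
proof -
  define q where "q = int p"
  define V where "V = {0..<q}"
  define L where "L = (\<lambda>a. Legendre a q)"
  \<comment> \<open>Twice the adjacency indicator on V, written through the quadratic character, so
    that degrees and common neighbours become character sums.\<close>
  define ind where "ind = (\<lambda>x y. 1 + L (x - y) - (if x = y then 1 else 0 :: int))"
  have "p \<noteq> 2" using p by auto
  hence p2: "p > 2" using p prime_ge_2_nat[of p] by simp
  have p5: "p \<ge> 5" using p p2 by presburger
  have q: "prime q" "q > 2" "q > 0" using p p2 by (auto simp: q_def)
  have finV: "finite V" by (simp add: V_def)
  have vals: "L a \<in> {-1, 0, 1}" for a unfolding L_def by (rule Legendre_values)
  have mult: "L (a * b) = L a * L b" for a b unfolding L_def using q by (intro Legendre_mult)
  \<comment> \<open>Here p = 1 modulo 4 enters: the exponent (p - 1) / 2 is even. This makes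
    adjacency symmetric.\<close>
  have "L (-1) = 1" unfolding L_def
  proof (rule Legendre_eq_if_cong)
    obtain m where m: "p = 4 * m + 1" using p(2) by (metis mult_div_mod_eq add.commute)
    have "[Legendre (-1) (int p) = (-1) ^ ((p - 1) div 2)] (mod int p)"
      using p p2 by (intro euler_criterion) auto
    also have "(p - 1) div 2 = 2 * m" by (simp add: m)
    finally show "[Legendre (-1) q = 1] (mod q)" by (simp add: q_def)
  qed (use q Legendre_values in auto)
  hence sym: "L (x - y) = L (y - x)" for x y using mult[of "-1" "y - x"] by simp
  have dvd: "q dvd x - y \<longleftrightarrow> x = y" if "x \<in> V" "y \<in> V" for x y
  proof
    assume "q dvd x - y"
    moreover have "\<bar>x - y\<bar> < q" using that by (auto simp: V_def)
    ultimately show "x = y" using dvd_imp_le_int[of "x - y" q] by (cases "x = y") auto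
  qed simp
  have L0: "L (x - y) = 0 \<longleftrightarrow> x = y" if "x \<in> V" "y \<in> V" for x y
    using Legendre_eq_0_iff[OF q(1,2)] dvd[OF that] unfolding L_def by simp
  have arc: "(x, y) \<in> parcs (paley_graph p) \<longleftrightarrow> x \<in> V \<and> y \<in> V \<and> L (x - y) = 1" for x y
    by (auto simp: paley_graph_def V_def L_def q_def Legendre_def)
  have verts: "pverts (paley_graph p) = V" by (simp add: paley_graph_def V_def q_def)
  have ind: "ind x y = (if (x, y) \<in> parcs (paley_graph p) then 2 else 0)" if "x \<in> V" "y \<in> V" for x y
    using that L0[OF that] vals[of "x - y"] by (auto simp: ind_def arc)
  have nb: "neighbours (paley_graph p) x = {y\<in>V. (x, y) \<in> parcs (paley_graph p)}" for x
    by (auto simp: neighbours_def arc)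
  have sumL: "(\<Sum>z\<in>V. L (x - z)) = 0" for x
    using sum_Legendre_affine[OF q(1,2), of "-1" x] by (simp add: L_def V_def)
  have cardV: "int (card V) = q" using q by (simp add: V_def)
  have delta: "(\<Sum>z\<in>V. (if x = z then 1 else 0) * f z) = f x" if "x \<in> V" for x and f :: "int \<Rightarrow> int"
    using that finV by (simp add: if_distrib[of "\<lambda>t. t * _"] cong: if_cong)
  have delta1: "(\<Sum>z\<in>V. if x = z then 1 else 0 :: int) = 1" if "x \<in> V" for x
    using delta[OF that, of "\<lambda>_. 1"] by simp

  have degree: "2 * int (card (neighbours (paley_graph p) x)) = q - 1" if x: "x \<in> V" for x
  proof -
    have "2 * int (card (neighbours (paley_graph p) x)) = (\<Sum>y\<in>neighbours (paley_graph p) x. 2)" by simp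
    also have "\<dots> = (\<Sum>y\<in>V. ind x y)"
      unfolding nb using finV x by (intro sum.mono_neutral_cong_left) (auto simp: ind)
    also have "\<dots> = q - 1"
      unfolding ind_def sum_subtractf sum.distrib sumL delta1[OF x] using cardV by simp
    finally show ?thesis .
  qed

  have common: "4 * int (card (neighbours (paley_graph p) x \<inter> neighbours (paley_graph p) y)) = q - 3 - 2 * L (x - y)"
    if xy: "x \<in> V" "y \<in> V" "x \<noteq> y" for x y
  proof -
    have "4 * int (card (neighbours (paley_graph p) x \<inter> neighbours (paley_graph p) y)) =
        (\<Sum>z\<in>neighbours (paley_graph p) x \<inter> neighbours (paley_graph p) y. 4)" by simp
    also have "\<dots> = (\<Sum>z\<in>V. ind x z * ind y z)"
      unfolding nb using finV xy by (intro sum.mono_neutral_cong_left) (auto simp: ind)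
    \<comment> \<open>The product of the two diagonal indicators vanishes because x and y
      differ.\<close>
    also have "\<dots> = (\<Sum>z\<in>V. 1 + L (x - z) + L (y - z) + L (x - z) * L (y - z)
        - (if x = z then 1 else 0) * (1 + L (y - z)) - (if y = z then 1 else 0) * (1 + L (x - z)))"
      using xy(3) by (intro sum.cong refl) (auto simp: ind_def algebra_simps)
    also have "\<dots> = q + (\<Sum>z\<in>V. L (x - z) * L (y - z)) - (1 + L (y - x)) - (1 + L (x - y))"
      unfolding sum_subtractf sum.distrib sumL using delta[OF xy(1), of "\<lambda>z. 1 + L (y - z)"]
        delta[OF xy(2), of "\<lambda>z. 1 + L (x - z)"] cardV by simp
    also have "(\<Sum>z\<in>V. L (x - z) * L (y - z)) = (\<Sum>z\<in>V. L ((1 * z + - x) mod q) * L ((1 * z + - x) mod q + (x - y)))"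
    proof (rule sum.cong[OF refl])
      fix z
      have "L ((1 * z + - x) mod q) = L (z - x)" by (simp add: L_def)
      moreover have "L ((1 * z + - x) mod q + (x - y)) = L (((1 * z + - x) mod q + (x - y)) mod q)"
        by (simp add: L_def)
      moreover have "((1 * z + - x) mod q + (x - y)) mod q = (z - y) mod q"
        by (simp add: mod_add_left_eq)
      moreover have "L ((z - y) mod q) = L (z - y)" by (simp add: L_def)
      ultimately show "L (x - z) * L (y - z) = L ((1 * z + - x) mod q) * L ((1 * z + - x) mod q + (x - y))"
        using sym[of x z] sym[of y z] by simp
    qed
    also have "\<dots> = (\<Sum>z\<in>V. L z * L (z + (x - y)))"
      unfolding V_def by (rule sum_mod_affine) (use q in auto)
    also have "\<dots> = -1"
      unfolding V_def L_def by (rule sum_Legendre_shift) (use q dvd xy in auto)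
    finally show ?thesis using sym[of x y] by simp
  qed

  show ?thesis
    unfolding strongly_regular_def verts
  proof (intro conjI ballI impI)
    have "parcs (paley_graph p) \<subseteq> V \<times> V" by (auto simp: arc)
    hence fin: "finite (parcs (paley_graph p))" using finV finite_subset by blast
    show "pair_graph (paley_graph p)"
    proof
      show "symmetric (with_proj (paley_graph p))"
        by (auto simp: symmetric_def sym_def arc sym)
    qed (use fin finV Legendre_eq_0_iff[OF q(1,2), of 0] in \<open>auto simp: arc verts L_def\<close>)
    show "card V = p" using cardV by (simp add: q_def)
    obtain m where m: "p = 4 * m + 5"
    proof
      show "p = 4 * ((p - 5) div 4) + 5" using p(2) p5 by presburger
    qed
    show "card (neighbours (paley_graph p) x) = (p - 1) div 2" if "x \<in> V" for x
      using degree[OF that] by (simp add: q_def m)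
    show "card (neighbours (paley_graph p) x \<inter> neighbours (paley_graph p) y) = (p - 5) div 4"
      if "x \<in> V" "y \<in> V" "(x, y) \<in> parcs (paley_graph p)" for x y
    proof -
      have L1: "L (x - y) = 1" using that(3) by (simp add: arc)
      hence "x \<noteq> y" using L0[OF that(1,2)] by auto
      thus ?thesis using common[OF that(1,2)] L1 by (simp add: q_def m)
    qed
    show "card (neighbours (paley_graph p) x \<inter> neighbours (paley_graph p) y) = (p - 1) div 4"
      if "x \<in> V" "y \<in> V" "x \<noteq> y \<and> (x, y) \<notin> parcs (paley_graph p)" for x y
    proof -
      have "L (x - y) \<noteq> 0" "L (x - y) \<noteq> 1" using that L0[OF that(1,2)] by (auto simp: arc)
      hence "L (x - y) = -1" using vals[of "x - y"] by auto
      thus ?thesis using common[OF that(1,2)] that(3) by (simp add: q_def m)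
    qed
  qed
qed

text \<open>For the definite description to pick these parameters, one adjacent and one non-adjacent
  pair are exhibited: (1, 0), and (e, 0) with a nonresidue e.\<close>

lemma srg_params_paley_graph:
  assumes p: "prime p" "p mod 4 = 1"
  shows "srg_params (paley_graph p) = (p, (p - 1) div 2, (p - 5) div 4, (p - 1) div 4)"
proof -
  have "p \<noteq> 2" using p by auto
  hence p2: "p > 2" using p prime_ge_2_nat[of p] by simp
  have q: "prime (int p)" "int p > 2" using p p2 by auto
  obtain g where g: "Legendre g (int p) = -1" using ex_nonresidue[OF q] by blast
  define e where "e = g mod int p"
  have "Legendre e (int p) = -1" using g by (simp add: e_def)
  hence e: "\<not> QuadRes (int p) e" "e \<noteq> 0" by (auto simp: Legendre_def split: if_splits)
  have one: "QuadRes (int p) 1" unfolding QuadRes_def by (rule exI[of _ 1]) simp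
  show ?thesis
  proof (rule srg_params_eq)
    show "strongly_regular (paley_graph p) p ((p - 1) div 2) ((p - 5) div 4) ((p - 1) div 4)"
      by (rule strongly_regular_paley_graph[OF p])
    show "(1, 0) \<in> parcs (paley_graph p)" using one p2 by (simp add: paley_graph_def Cong.cong_def)
    show "(e, 0) \<notin> parcs (paley_graph p)" using e by (simp add: paley_graph_def)
  qed (use p2 e in \<open>auto simp: paley_graph_def e_def\<close>)
qed

section \<open>The two bounds for the Paley graph\<close>

context
  fixes p m :: nat
  assumes p: "prime p" "p = 4 * m + 5"
begin

text \<open>Writing p = 4 m + 5 removes all truncated subtractions and divisions, so the later
  identities are polynomial in m.\<close>

lemma srg_params_paley_graph_4m5: "srg_params (paley_graph p) = (p, 2 * m + 2, m, m + 1)"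
proof -
  have e: "p - 1 = 2 * (2 * m + 2)" "p - 5 = 4 * m" "p - 1 = 4 * (m + 1)" "p = 1 + 4 * (m + 1)"
    using p(2) by simp_all
  have "(p - 1) div 2 = 2 * m + 2" unfolding e(1) by (rule nonzero_mult_div_cancel_left) simp
  moreover have "(p - 5) div 4 = m" unfolding e(2) by (rule nonzero_mult_div_cancel_left) simp
  moreover have "(p - 1) div 4 = m + 1" unfolding e(3) by (rule nonzero_mult_div_cancel_left) simp
  moreover have "(1 + 4 * (m + 1)) mod 4 = 1" by (simp only: mod_mult_self2) simp
  hence "p mod 4 = 1" by (simp only: e(4)[symmetric])
  ultimately show ?thesis using srg_params_paley_graph[OF p(1)] by (simp only:)
qed

lemma srg_sigma_paley_graph: "srg_sigma (paley_graph p) = (- 1 - sqrt p) / 2"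
proof -
  have "restricted_eigenvalues (paley_graph p) = {(- 1 - sqrt p) / 2, (- 1 + sqrt p) / 2}"
  proof -
    have pm: "real p = 4 * real m + 5" using p by simp
    have "t\<^sup>2 - (real m - real (m + 1)) * t - (real (2 * m + 2) - real (m + 1)) = 0 \<longleftrightarrow>
        t = (- 1 - sqrt p) / 2 \<or> t = (- 1 + sqrt p) / 2" for t
    proof -
      have "t\<^sup>2 - (real m - real (m + 1)) * t - (real (2 * m + 2) - real (m + 1)) =
          t\<^sup>2 + t + 1 / 4 - real p / 4" by (simp add: pm field_simps)
      also have "\<dots> = t\<^sup>2 + t + 1 / 4 - (sqrt p)\<^sup>2 / 4" by simp
      also have "\<dots> = (t - (- 1 - sqrt p) / 2) * (t - (- 1 + sqrt p) / 2)"
        by (simp add: field_simps power2_eq_square)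
      finally show ?thesis by simp
    qed
    thus ?thesis unfolding restricted_eigenvalues_def srg_params_paley_graph_4m5 prod.case
      by blast
  qed
  moreover have "sqrt p \<ge> 0" by simp
  ultimately show ?thesis unfolding srg_sigma_def by (simp add: min_def)
qed

lemma haem_ge_paley_graph: "haem_ge (paley_graph p) d = sqrt p * (2 * d + 1 + sqrt p) / (sqrt p + 1)"
proof -
  define s where "s = sqrt p"
  have s: "s > 0" using p by (simp add: s_def)
  have ps: "real p = s * s" by (simp add: s_def)
  have ms: "2 * real m + 2 = (s * s - 1) / 2" using ps p by simp
  have num: "real d - (- 1 - s) / 2 = (2 * d + 1 + s) / 2" by (simp add: field_simps)
  have "(s * s - 1) / 2 - (- 1 - s) / 2 = s * (s + 1) / 2" by (simp add: field_simps)
  hence den: "real (2 * m + 2) - (- 1 - s) / 2 = s * (s + 1) / 2" by (simp only: of_nat_add of_nat_mult of_nat_numeral ms)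
  have "haem_ge (paley_graph p) d = (s * s) * ((2 * d + 1 + s) / 2 / (s * (s + 1) / 2))"
    unfolding haem_ge_def srg_params_paley_graph_4m5 srg_sigma_paley_graph prod.case s_def[symmetric]
    unfolding num den ps ..
  also have "\<dots> = (s * s) * ((2 * d + 1 + s) / (s * (s + 1)))"
  proof -
    have "x / 2 / (y / 2) = x / y" for x y :: real by simp
    thus ?thesis by (simp only:)
  qed
  also have "\<dots> = s * (2 * d + 1 + s) / (s + 1)"
    using s by simp
  finally show ?thesis by (simp add: s_def)
qed

lemma srg_R_paley_graph:
  "srg_R (paley_graph p) x y d = (int p - y) * x\<^sup>2 + (int p * (1 - y) + 2 * y * d) * x +
     (y * (y - 1) * (int m + 1) - y * d\<^sup>2)"
  unfolding srg_R_def srg_params_paley_graph_4m5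
  by (simp add: p algebra_simps power2_eq_square)

text \<open>The point n + d is the integer close to the real minimum in x when p is about 4 n^2 and
  n is large; \<open>2 * m + 3\<close> is (p + 1) / 2.\<close>

lemma srg_R_paley_graph_even:
  "srg_R (paley_graph p) (n + d) (2 * n + 2 * d) d = (n + d) * (2 * int m + 3 - 2 * n\<^sup>2 - n - d)"
  unfolding srg_R_paley_graph by (simp add: p algebra_simps power2_eq_square)

text \<open>A quadratic w x^2 + b x + c with w > 0 is negative at the integer nearest to its vertex
  as soon as b^2 - 4 w c > w^2. The difference of these two sides factors so that its sign is
  visible from z^2 > p.\<close>

lemma ex_srg_R_paley_graph_neg:
  fixes y d z :: int
  assumes y: "0 < y" "y < int p" and z: "z = y - 2 * d" "int p < z\<^sup>2" and d: "0 \<le> d"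
  shows "\<exists>x. srg_R (paley_graph p) x y d < 0"
proof -
  define w where "w = int p - y"
  define b where "b = int p * (1 - y) + 2 * y * d"
  define c where "c = y * (y - 1) * (int m + 1) - y * d\<^sup>2"
  \<comment> \<open>This is -b / (2 w) rounded to a nearest integer, so |2 w x + b| is at most
    w.\<close>
  define x where "x = (w - b) div (2 * w)"
  have w: "w > 0" using y by (simp add: w_def)
  have "2 * w * x \<le> w - b" "w - b < 2 * w * x + 2 * w"
    unfolding x_def using w pos_mod_bound[of "2 * w" "w - b"] pos_mod_sign[of "2 * w" "w - b"]
      mult_div_mod_eq[of "2 * w" "w - b"] by linarith+
  hence "\<bar>2 * w * x + b\<bar> \<le> w" by linarith
  hence sq: "(2 * w * x + b)\<^sup>2 \<le> w\<^sup>2" using power_mono[of "\<bar>2 * w * x + b\<bar>" w 2] by simp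
  have "b\<^sup>2 - 4 * w * c - w\<^sup>2 = y * ((int p - 1) * (z\<^sup>2 - int p) + 4 * d * (int p - y + d))"
    unfolding w_def b_def c_def z(1) by (simp add: p algebra_simps power2_eq_square)
  moreover have "0 < y * ((int p - 1) * (z\<^sup>2 - int p) + 4 * d * (int p - y + d))"
    using y z d p by (intro mult_pos_pos add_pos_nonneg mult_nonneg_nonneg) auto
  ultimately have "w\<^sup>2 < b\<^sup>2 - 4 * w * c" by linarith
  hence "(2 * w * x + b)\<^sup>2 - (b\<^sup>2 - 4 * w * c) < 0" using sq by linarith
  also have "(2 * w * x + b)\<^sup>2 - (b\<^sup>2 - 4 * w * c) = 4 * w * (w * x\<^sup>2 + b * x + c)"
    by (simp add: algebra_simps power2_eq_square)
  finally have "w * x\<^sup>2 + b * x + c < 0" using w by (simp add: mult_less_0_iff)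
  thus ?thesis unfolding srg_R_paley_graph w_def b_def c_def by blast
qed

text \<open>At y = p the leading coefficient vanishes. What remains is linear in x with slope -2 p
  (k - d), where k = 2 m + 2 > d, and is negative for large x.\<close>

lemma ex_srg_R_paley_graph_neg_full:
  assumes d: "d < 2 * int m + 2"
  shows "\<exists>x. srg_R (paley_graph p) x (int p) d < 0"
proof -
  define x where "x = (int p - 1) * (int m + 1) + 1"
  have x: "x > 0" using p by (simp add: x_def add_nonneg_pos)
  have "1 * x \<le> (2 * int m + 2 - d) * x" using d x by (intro mult_right_mono) auto
  moreover have "(int p - 1) * (int m + 1) - d\<^sup>2 < x" by (simp add: x_def)
  ultimately have "(int p - 1) * (int m + 1) - d\<^sup>2 - 2 * ((2 * int m + 2 - d) * x) < 0" using x by linarith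
  hence "int p * ((int p - 1) * (int m + 1) - d\<^sup>2 - 2 * ((2 * int m + 2 - d) * x)) < 0"
    using p by (intro mult_pos_neg) auto
  also have "int p * ((int p - 1) * (int m + 1) - d\<^sup>2 - 2 * ((2 * int m + 2 - d) * x)) = srg_R (paley_graph p) x (int p) d"
    unfolding srg_R_paley_graph by (simp add: p algebra_simps power2_eq_square)
  finally show ?thesis by blast
qed

lemma rab_ge_paley_graph_less:
  fixes n d :: nat
  assumes upper: "2 * m + 3 < 2 * n\<^sup>2 + n + d" and square: "p < (2 * n + 1)\<^sup>2" and n: "0 < n" and d: "d < 2 * m + 2"
  shows "rab_ge (paley_graph p) d < 2 * n + 2 * d"
proof -
  have "y < 2 * n + 2 * d" if y: "y \<in> rab_set (paley_graph p) d" for y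
  proof (rule ccontr)
    assume ge: "\<not> y < 2 * n + 2 * d"
    have R: "0 \<le> srg_R (paley_graph p) x (int y) (int d)" for x
      using y unfolding rab_set_def srg_params_paley_graph_4m5 by simp
    have yp: "y \<le> p" using y unfolding rab_set_def srg_params_paley_graph_4m5 by simp
    consider "y = 2 * n + 2 * d" | "y = p" | "2 * n + 2 * d < y" "y < p" using ge yp by linarith
    thus False
    proof cases
      case 1
      have "int (2 * m + 3) < int (2 * n\<^sup>2 + n + d)" using upper by (simp only: of_nat_less_iff)
      hence "(int n + int d) * (2 * int m + 3 - 2 * (int n)\<^sup>2 - int n - int d) < 0"
        using n by (intro mult_pos_neg) auto
      thus False using R[of "int n + int d"] srg_R_paley_graph_even[of "int n" "int d"] 1 by simp
    next
      case 2
      thus False using ex_srg_R_paley_graph_neg_full[of "int d"] R d by (auto simp: not_le[symmetric])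
    next
      case 3
      define z where "z = int y - 2 * int d"
      have z: "2 * int n + 1 \<le> z" using 3 by (simp add: z_def)
      have "int p < int ((2 * n + 1)\<^sup>2)" using square by (simp only: of_nat_less_iff)
      also have "int ((2 * n + 1)\<^sup>2) \<le> z\<^sup>2" using power_mono[OF z, of 2] by (simp add: add.commute)
      finally have "int p < z\<^sup>2" .
      then obtain x where "srg_R (paley_graph p) x (int y) (int d) < 0"
        using ex_srg_R_paley_graph_neg[of "int y" z "int d"] 3 z_def by auto
      thus False using R[of x] by simp
    qed
  qed
  moreover have "finite (rab_set (paley_graph p) d)"
    unfolding rab_set_def srg_params_paley_graph_4m5 by simp
  \<comment> \<open>For an empty set the value is 0, and \<open>0 < n\<close> keeps the inequality
    strict.\<close>
  ultimately show ?thesis using n unfolding rab_ge_def by auto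
qed

end

theorem theorem6p8:
  fixes d :: nat
  shows "infinite {p :: nat. prime p \<and> [p = 1] (mod 4) \<and>
           int (rab_ge (paley_graph p) d) < \<lfloor>haem_ge (paley_graph p) d\<rfloor>}"
proof -
  obtain eta :: real where eta: "eta > 0" and
    inf: "infinite {p::nat. prime p \<and> p mod 4 = 1 \<and> (\<exists>n::nat. 2 * real n + eta \<le> sqrt p \<and> sqrt p \<le> 2 * real n + 1 / 2 - eta)}"
    (is "infinite ?G") using infinite_primes_1_mod_4_sqrt_window by blast
  \<comment> \<open>Once sqrt p reaches \<open>B\<close>, the third entry gives 2 n eta \<ge> 1 and
    the last gives 2 d \<le> eta sqrt p.\<close>
  define B where "B = max (max 3 (2 * real d)) (max (1 / eta + 1) (2 * real d / eta))"
  define N where "N = max (nat \<lceil>B\<^sup>2\<rceil>) (2 * d + 5)"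
  have "infinite (?G - {..N})" using inf by simp
  moreover have "?G - {..N} \<subseteq> {p :: nat. prime p \<and> [p = 1] (mod 4) \<and>
           int (rab_ge (paley_graph p) d) < \<lfloor>haem_ge (paley_graph p) d\<rfloor>}"
  proof
    fix p :: nat
    assume "p \<in> ?G - {..N}"
    then obtain n :: nat where p: "prime p" "p mod 4 = 1" "p \<notin> {..N}"
      and n: "2 * real n + eta \<le> sqrt p" "sqrt p \<le> 2 * real n + 1 / 2 - eta"
      by blast
    have p_cong: "[p = 1] (mod 4)" using p by (simp add: Cong.cong_def)
    define s where "s = sqrt p"
    have pN: "nat \<lceil>B\<^sup>2\<rceil> \<le> p" "2 * d + 5 \<le> p"
      using p(3) max.cobounded1[of "nat \<lceil>B\<^sup>2\<rceil>" "2 * d + 5"] max.cobounded2[of "2 * d + 5" "nat \<lceil>B\<^sup>2\<rceil>"]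
      unfolding N_def atMost_iff by linarith+
    have "B\<^sup>2 \<le> real p" using pN(1) by linarith
    hence Bs: "B \<le> s" unfolding s_def by (rule real_le_rsqrt)
    have sB: "3 \<le> s" "1 / eta + 1 \<le> s" "2 * real d / eta \<le> s" using Bs by (simp_all add: B_def)
    define m where "m = (p - 5) div 4"
    have pm: "p = 4 * m + 5"
    proof -
      have "p = 4 * (p div 4) + 1" using p(2) by (metis mult_div_mod_eq)
      moreover from this have "p - 5 = 4 * (p div 4 - 1)" using pN(2) by linarith
      ultimately show ?thesis using pN(2) by (simp add: m_def)
    qed
    have ps: "real p = s * s" by (simp add: s_def)
    have ns: "2 * real n + eta \<le> s" "s \<le> 2 * real n + 1 / 2 - eta" using n by (simp_all add: s_def)
    have eta_le: "eta \<le> 1 / 4" using ns by linarith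
    have "1 / eta \<le> 2 * real n" using sB(2) ns(2) eta by linarith
    hence en: "1 \<le> eta * (2 * real n)" using eta by (simp add: field_simps)
    have n_pos: "n > 0" using en by (cases n) auto
    \<comment> \<open>The square is 4 n^2 + 2 n + 1/4 minus at least 2 from the cross term 4 n eta.
      This slack yields p + 1 < 4 n^2 + 2 n, hence the negativity of \<open>R\<close> at y = 2 n + 2
      d.\<close>
    have "s * s \<le> (2 * real n + 1 / 2 - eta) * (2 * real n + 1 / 2 - eta)"
      using ns sB by (intro mult_mono) auto
    also have "\<dots> = 4 * (real n * real n) + 2 * real n + 1 / 4 - 2 * (eta * (2 * real n)) - eta * (1 - eta)"
      by (simp add: field_simps)
    also have "\<dots> < 4 * (real n * real n) + 2 * real n - 1"
      using en mult_nonneg_nonneg[of eta "1 - eta"] eta eta_le by linarith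
    finally have less: "real p + 1 < 4 * (real n * real n) + 2 * real n" using ps by linarith
    have p_less: "p + 1 < 4 * (n * n) + 2 * n"
    proof -
      have "real (p + 1) < real (4 * (n * n) + 2 * n)" using less by simp
      thus ?thesis by (simp only: of_nat_less_iff)
    qed
    have "rab_ge (paley_graph p) d < 2 * n + 2 * d"
    proof (rule rab_ge_paley_graph_less[OF p(1) pm])
      show "2 * m + 3 < 2 * n\<^sup>2 + n + d" using p_less pm by (simp add: power2_eq_square)
      show "p < (2 * n + 1)\<^sup>2" using p_less by (simp add: power2_eq_square algebra_simps)
      show "d < 2 * m + 2" using pN(2) pm by simp
    qed fact
    moreover have "2 * real n + 2 * real d \<le> haem_ge (paley_graph p) d"
    proof -
      \<comment> \<open>With s = sqrt p, the eigenvalue bound minus 2 n + 2 d equals ((s - 2 n) (s +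
        1) - 2 d) / (s + 1), so it is enough to compare (s - 2 n) (s + 1) with 2 d.\<close>
      have "2 * real d \<le> eta * s" using sB(3) eta by (simp add: field_simps)
      also have "\<dots> \<le> (s - 2 * real n) * (s + 1)"
        using ns(1) eta sB by (intro mult_mono) auto
      finally have "(2 * real n + 2 * real d) * (s + 1) \<le> s * (2 * real d + 1 + s)"
        by (simp add: algebra_simps)
      thus ?thesis using sB unfolding haem_ge_paley_graph[OF p(1) pm] s_def[symmetric]
        by (simp add: field_simps)
    qed
    hence "int (2 * n + 2 * d) \<le> \<lfloor>haem_ge (paley_graph p) d\<rfloor>"
      by (simp add: le_floor_iff)
    ultimately have "int (rab_ge (paley_graph p) d) < \<lfloor>haem_ge (paley_graph p) d\<rfloor>" by linarith
    thus "p \<in> {p :: nat. prime p \<and> [p = 1] (mod 4) \<and>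
           int (rab_ge (paley_graph p) d) < \<lfloor>haem_ge (paley_graph p) d\<rfloor>}"
      using p(1) p_cong by blast
  qed
  ultimately show ?thesis using infinite_super by blast
qed

end
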